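(* Let $M$ be an $n$-dimensional triangulated piecewise Euclidean manifold (possibly with boundary). Then $M$ is discretely conformally flat if and only if every interior vertex $v_0$ of $M$ satisfies the following condition: there exists a convex polytope in $\mathbb{R}^n$ whose boundary is triangulated by a simplicial complex combinatorially equivalent to the link of $v_0$ (via a bijection of vertices $v_i \mapsto p_i$), such that for every edge $[v_i,v_j]$ of the link of $v_0$ the corresponding edge has length $$|p_i-p_j| = \tilde\ell_{ij} = \frac{\ell_{ij}}{\ell_{0i}\,\ell_{0j}},$$ where $\ell_{ij}$ denotes the length in $M$ of the edge between adjacent vertices $v_i,v_j$ of $M$.
   Context: A triangulated piecewise Euclidean manifold is an $n$-manifold (possibly with boundary) obtained by gluing Euclidean $n$-simplices along their $(n-1)$-faces by isometries, together with the resulting triangulation (simplicial complex structure); each edge $[v_i,v_j]$ then has a length $\ell_{ij}$. The vertex star of a vertex $v$ is the union of all closed simplices containing $v$, and the link of $v$ is the subcomplex of simplices of the star not containing $v$. Two such triangulated objects with vertex sets $V,V'$ are discretely conformally equivalent if there is a combinatorial isomorphism $\phi:V\to V'$ (a vertex bijection such that vertex sets span simplices in one exactly when their images span simplices in the other) and a function $u:V\to\mathbb{R}$ such that for every edge $[v_1,v_2]$, $\ell'(\phi(v_1),\phi(v_2)) = e^{\frac12(u(v_1)+u(v_2))}\ell(v_1,v_2)$. A discrete domain is a locally finite simplicial complex $K$ in $\mathbb{R}^n$ such that: (i) $K$ is pure $n$-dimensional; (ii) every $n$-simplex of $K$ has at least one vertex in the interior of the carrier $|K|$; (iii) the subgraph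 of the 1-skeleton of $K$ induced by the interior vertices is connected. It is locally Delaunay if for every $n$-simplex $\sigma\in K$, the open ball bounded by the circumsphere of $\sigma$ contains no vertex of any $n$-simplex of $K$ sharing an $(n-1)$-face with $\sigma$. A triangulated piecewise Euclidean manifold is discretely conformally flat if the vertex star of every interior vertex is discretely conformally equivalent to a locally Delaunay discrete domain in $\mathbb{R}^n$. *)

theory Defs
  imports "HOL-Analysis.Analysis"
begin

definition abs_complex :: "'v set set \<Rightarrow> bool" where
  "abs_complex K \<longleftrightarrow>
     (\<forall>\<sigma>\<in>K. \<sigma> \<noteq> {} \<and> finite \<sigma>) \<and>
     (\<forall>\<sigma>\<in>K. \<forall>\<tau>. \<tau> \<subseteq> \<sigma> \<and> \<tau> \<noteq> {} \<longrightarrow> \<tau> \<in> K)"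

definition abs_locally_finite :: "'v set set \<Rightarrow> bool" where
  "abs_locally_finite K \<longleftrightarrow> (\<forall>v. finite {\<sigma>\<in>K. v \<in> \<sigma>})"

definition pure_dim :: "nat \<Rightarrow> 'a set set \<Rightarrow> bool" where
  "pure_dim n K \<longleftrightarrow>
     (\<forall>\<sigma>\<in>K. card \<sigma> \<le> n + 1) \<and> (\<forall>\<sigma>\<in>K. \<exists>\<tau>\<in>K. \<sigma> \<subseteq> \<tau> \<and> card \<tau> = n + 1)"

text \<open>Standard geometric realisation of an abstract complex, as a subspace of
  'v \<Rightarrow> real with the product topology (which is the correct topology for
  locally finite complexes).\<close>
definition realization :: "'v set set \<Rightarrow> ('v \<Rightarrow> real) set" where
  "realization K = {x. (\<forall>v. 0 \<le> x v) \<and> {v. x v \<noteq> 0} \<in> K \<and> (\<Sum>v\<in>{v. x v \<noteq> 0}. x v) = 1}"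

definition topological_manifold_wb :: "'n::finite itself \<Rightarrow> ('a::topological_space) set \<Rightarrow> bool" where
  "topological_manifold_wb N X \<longleftrightarrow>
     (\<forall>x\<in>X. \<exists>U (V :: (real^'n) set) k.
        x \<in> U \<and> openin (top_of_set X) U \<and>
        openin (top_of_set {y. 0 \<le> y $ k}) V \<and> U homeomorphic V)"

definition tri_pe_manifold ::
  "'n::finite itself \<Rightarrow> 'v set set \<Rightarrow> ('v \<Rightarrow> 'v \<Rightarrow> real) \<Rightarrow> bool" where
  "tri_pe_manifold N K l \<longleftrightarrow>
     abs_complex K \<and> abs_locally_finite K \<and> pure_dim CARD('n) K \<and>
     topological_manifold_wb N (realization K) \<and>
     (\<forall>a b. l a b = l b a) \<and>
     (\<forall>\<sigma>\<in>K. card \<sigma> = CARD('n) + 1 \<longrightarrow>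
        (\<exists>f :: 'v \<Rightarrow> real^'n. inj_on f \<sigma> \<and> \<not> affine_dependent (f ` \<sigma>) \<and>
           (\<forall>a\<in>\<sigma>. \<forall>b\<in>\<sigma>. a \<noteq> b \<longrightarrow> dist (f a) (f b) = l a b)))"

definition interior_vertex :: "nat \<Rightarrow> 'v set set \<Rightarrow> 'v \<Rightarrow> bool" where
  "interior_vertex n K v \<longleftrightarrow> v \<in> \<Union>K \<and>
     \<not> (\<exists>F\<in>K. card F = n \<and> v \<in> F \<and> (\<exists>!\<sigma>. \<sigma> \<in> K \<and> card \<sigma> = n + 1 \<and> F \<subseteq> \<sigma>))"

definition vertex_star :: "'v set set \<Rightarrow> 'v \<Rightarrow> 'v set set" where
  "vertex_star K v = {\<tau>\<in>K. \<exists>\<sigma>\<in>K. v \<in> \<sigma> \<and> \<tau> \<subseteq> \<sigma>}"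

definition vertex_link :: "'v set set \<Rightarrow> 'v \<Rightarrow> 'v set set" where
  "vertex_link K v = {\<tau>\<in>vertex_star K v. v \<notin> \<tau>}"

definition geom_complex :: "('n::finite) itself \<Rightarrow> (real^'n) set set \<Rightarrow> bool" where
  "geom_complex N D \<longleftrightarrow>
     (\<forall>\<sigma>\<in>D. \<sigma> \<noteq> {} \<and> finite \<sigma> \<and> \<not> affine_dependent \<sigma>) \<and>
     (\<forall>\<sigma>\<in>D. \<forall>\<tau>. \<tau> \<subseteq> \<sigma> \<and> \<tau> \<noteq> {} \<longrightarrow> \<tau> \<in> D) \<and>
     (\<forall>\<sigma>\<in>D. \<forall>\<tau>\<in>D. convex hull \<sigma> \<inter> convex hull \<tau> = convex hull (\<sigma> \<inter> \<tau>)) \<and>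
     (\<forall>x. \<exists>e>0. finite {\<sigma>\<in>D. convex hull \<sigma> \<inter> ball x e \<noteq> {}})"

definition carrier :: "(real^'n) set set \<Rightarrow> (real^'n) set" where
  "carrier D = (\<Union>\<sigma>\<in>D. convex hull \<sigma>)"

definition discrete_domain :: "'n::finite itself \<Rightarrow> (real^'n) set set \<Rightarrow> bool" where
  "discrete_domain N D \<longleftrightarrow>
     geom_complex N D \<and> pure_dim CARD('n) D \<and>
     (\<forall>\<sigma>\<in>D. card \<sigma> = CARD('n) + 1 \<longrightarrow> (\<exists>p\<in>\<sigma>. p \<in> interior (carrier D))) \<and>
     (let IV = \<Union>D \<inter> interior (carrier D) in
        \<forall>p\<in>IV. \<forall>q\<in>IV. (\<lambda>a b. a \<in> IV \<and> b \<in> IV \<and> {a, b} \<in> D)\<^sup>*\<^sup>* p q)"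

definition locally_delaunay :: "'n::finite itself \<Rightarrow> (real^'n) set set \<Rightarrow> bool" where
  "locally_delaunay N D \<longleftrightarrow>
     (\<forall>\<sigma>\<in>D. \<forall>\<sigma>'\<in>D. card \<sigma> = CARD('n) + 1 \<and> card \<sigma>' = CARD('n) + 1 \<and>
        card (\<sigma> \<inter> \<sigma>') = CARD('n) \<longrightarrow>
        (\<forall>c r. (\<forall>p\<in>\<sigma>. dist c p = r) \<longrightarrow> (\<forall>q\<in>\<sigma>'. \<not> dist c q < r)))"

definition disc_conf_equiv :: "'v set set \<Rightarrow> ('v \<Rightarrow> 'v \<Rightarrow> real) \<Rightarrow> (real^'n) set set \<Rightarrow> bool" where
  "disc_conf_equiv S l D \<longleftrightarrow>
     (\<exists>\<phi> (u :: 'v \<Rightarrow> real). bij_betw \<phi> (\<Union>S) (\<Union>D) \<and>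
        (\<forall>T. T \<subseteq> \<Union>S \<longrightarrow> (T \<in> S \<longleftrightarrow> \<phi> ` T \<in> D)) \<and>
        (\<forall>a b. {a, b} \<in> S \<and> a \<noteq> b \<longrightarrow>
           dist (\<phi> a) (\<phi> b) = exp ((u a + u b) / 2) * l a b))"

definition disc_conf_flat :: "'n::finite itself \<Rightarrow> 'v set set \<Rightarrow> ('v \<Rightarrow> 'v \<Rightarrow> real) \<Rightarrow> bool" where
  "disc_conf_flat N K l \<longleftrightarrow>
     (\<forall>v. interior_vertex CARD('n) K v \<longrightarrow>
        (\<exists>D :: (real^'n) set set. discrete_domain N D \<and> locally_delaunay N D \<and>
           disc_conf_equiv (vertex_star K v) l D))"

end

theory Submission
  imports Defs
begin

text \<open>Invert a vertex star in \<open>\<real>\<^sup>n\<close> in a sphere centred at its central vertex \<open>v\<^sub>0\<close>.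
  The distance formula \<open>|x' - y'| = r |x - y| / (|x| |y|)\<close> turns the conformally rescaled edge
  lengths into \<open>l\<^sub>i\<^sub>j / (l\<^sub>0\<^sub>i l\<^sub>0\<^sub>j)\<close>, where the radius absorbs the scale factor at \<open>v\<^sub>0\<close>. Circumspheres of the simplices
  of the star pass through the centre, so they become the hyperplanes spanned by the inverted link
  simplices, and the local Delaunay condition becomes local convexity of the inverted link.

  An interior vertex has no boundary facet, so in \<open>\<real>\<^sup>n\<close> the simplicial cones over the link
  simplices form a fan without boundary. A walk along a generic segment shows that the cones of such
  a fan cover \<open>\<real>\<^sup>n\<close>, and the same walk restricted to the facets whose functional is maximal at a
  given point upgrades local convexity to global convexity. Conversely, inverting the boundary
  complex of a polytope about an interior point yields a star whose circumballs are empty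
  because the facet hyperplanes support the polytope.\<close>

text \<open>The Delaunay condition compares only simplices that share a wall, whereas a polytope
  needs every facet plane to support all vertices. For a link facet F let \<open>a F\<close> be the
  functional with value 1 on F. The largest value of these functionals at y is the gauge of the
  polytope, and convexity amounts to this maximum being attained on a cone that contains y. Crossing
  a wall towards y never decreases the functional at y, so a walk that starts in a maximising facet
  stays among maximising facets.

  The radius is forced: the three conformal factors in the distance formula combine to
  \<open>exp (- u v0)\<close>, so r must be \<open>exp (u v0)\<close>. In the converse r is 1 and
  \<open>u v0\<close> is 0, and the other values of u are read off from the edges at the centre. A
  given polytope may a priori be degenerate; that it has an interior point to invert about must
  itself be derived from the absence of boundary in the link.\<close>

section \<open>Cones spanned by finite sets of vectors\<close>

definition pos :: "'a::real_vector set \<Rightarrow> 'a set" where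
  "pos S = {\<Sum>v\<in>S. c v *\<^sub>R v | c. \<forall>v\<in>S. 0 \<le> c v}"

lemma posI: "x = (\<Sum>v\<in>S. c v *\<^sub>R v) \<Longrightarrow> (\<And>v. v \<in> S \<Longrightarrow> 0 \<le> c v) \<Longrightarrow> x \<in> pos S"
  unfolding pos_def by blast

lemma posE:
  assumes "x \<in> pos S"
  obtains c where "x = (\<Sum>v\<in>S. c v *\<^sub>R v)" "\<And>v. v \<in> S \<Longrightarrow> 0 \<le> c v"
  using assms unfolding pos_def by blast

lemma zero_in_pos: "0 \<in> pos S"
  by (rule posI[where c = "\<lambda>_. 0"]) auto

lemma pos_scale: "x \<in> pos S \<Longrightarrow> 0 \<le> t \<Longrightarrow> t *\<^sub>R x \<in> pos S"
  by (elim posE, rule_tac c = "\<lambda>v. t * c v" in posI) (auto simp: scaleR_sum_right)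

subsection \<open>Coordinates with respect to a basis\<close>

definition is_basis :: "'a::euclidean_space set \<Rightarrow> bool" where
  "is_basis F \<longleftrightarrow> independent F \<and> card F = DIM('a)"

text \<open>For a basis, \<open>coord F x v\<close> is the dual functional of v applied to x; it is
  0 when v is not in F.\<close>

abbreviation "coord \<equiv> real_vector.representation"

lemma is_basisD:
  fixes F :: "'a::euclidean_space set"
  assumes "is_basis F"
  shows "independent F" "card F = DIM('a)" "finite F" "span F = UNIV"
proof -
  show i: "independent F" and c: "card F = DIM('a)" using assms by (auto simp: is_basis_def)
  show "finite F" using c by (metis card.infinite DIM_positive less_irrefl)
  then show "span F = UNIV"
    using i c by (metis dim_eq_full dim_span_eq_card_independent dim_span)
qed

lemma coord_sum:
  assumes "is_basis F" shows "(\<Sum>v\<in>F. coord F x v *\<^sub>R v) = x"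
  using is_basisD[OF assms] by (intro real_vector.sum_representation_eq) auto

lemma coord_unique:
  fixes F :: "'a::real_vector set"
  assumes "independent F" "finite F" "x = (\<Sum>v\<in>F. c v *\<^sub>R v)" "v \<in> F"
  shows "coord F x v = c v"
proof -
  have "coord F x = (\<lambda>v. if v \<in> F then c v else 0)"
  proof (rule real_vector.representation_eqI)
    show "x \<in> span F" unfolding assms(3) by (intro span_sum span_scale span_base)
    show "(\<Sum>b | (if b \<in> F then c b else 0) \<noteq> 0. (if b \<in> F then c b else 0) *\<^sub>R b) = x"
      unfolding assms(3) using assms(2) by (intro sum.mono_neutral_cong_left) auto
    show "finite {b. (if b \<in> F then c b else 0) \<noteq> 0}"
      by (rule finite_subset[OF _ assms(2)]) (auto split: if_splits)
  qed (use assms in \<open>auto split: if_splits\<close>)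
  then show ?thesis using assms by simp
qed

lemma coord_linear:
  assumes "is_basis F"
  shows "coord F (x + y) v = coord F x v + coord F y v"
    "coord F (x - y) v = coord F x v - coord F y v"
    "coord F (t *\<^sub>R x) v = t * coord F x v"
    "coord F 0 v = 0"
  using is_basisD[OF assms]
  by (auto simp: real_vector.representation_add real_vector.representation_diff
      real_vector.representation_scale real_vector.representation_zero)

lemma continuous_coord:
  fixes F :: "'a::euclidean_space set"
  assumes "is_basis F"
  shows "continuous_on S (\<lambda>x. coord F x v)"
proof -
  have "linear (\<lambda>x. coord F x v)"
    by (rule linearI) (simp_all add: coord_linear[OF assms])
  then show ?thesis by (rule linear_continuous_on[OF linear_linear[THEN iffD2]])
qed

lemma pos_iff_coord:
  assumes "is_basis F"
  shows "x \<in> pos F \<longleftrightarrow> (\<forall>v\<in>F. 0 \<le> coord F x v)"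
proof
  assume "x \<in> pos F"
  then show "\<forall>v\<in>F. 0 \<le> coord F x v"
    using coord_unique[OF is_basisD(1,3)[OF assms]] by (metis posE)
next
  assume "\<forall>v\<in>F. 0 \<le> coord F x v"
  then show "x \<in> pos F" by (intro posI[where c = "coord F x"]) (simp_all add: coord_sum assms)
qed

lemma closed_pos:
  assumes "is_basis F" shows "closed (pos F)"
proof -
  have "pos F = (\<Inter>v\<in>F. {x. 0 \<le> coord F x v})" by (auto simp: pos_iff_coord[OF assms])
  then show ?thesis
    by (auto intro!: closed_INT closed_Collect_le continuous_coord[OF assms])
qed

text \<open>A pivot step: w has a nonzero coefficient at v, so v can be eliminated in favour of w.
  Where \<open>coord F x v\<close> vanishes, as it does on the wall, the remaining coordinates do
  not change.\<close>

lemma coord_exchange: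
  assumes F: "is_basis F" and v: "v \<in> F" and w: "w \<notin> F"
    and G: "is_basis (insert w (F - {v}))" and nz: "coord F w v \<noteq> 0"
  shows "coord (insert w (F - {v})) x w = coord F x v / coord F w v"
    and "\<And>u. u \<in> F - {v} \<Longrightarrow>
      coord (insert w (F - {v})) x u = coord F x u - coord F w u * (coord F x v / coord F w v)"
proof -
  note fin = is_basisD(3)[OF F]
  \<comment> \<open>The coefficient of w: subtracting q times w from x removes its component at
    v.\<close>
  define q where "q = coord F x v / coord F w v"
  define c where "c u = (if u = w then q else coord F x u - coord F w u * q)" for u
  have "(\<Sum>u\<in>insert w (F - {v}). c u *\<^sub>R u)
      = q *\<^sub>R w + (\<Sum>u\<in>F - {v}. (coord F x u - coord F w u * q) *\<^sub>R u)"
    using w fin by (simp add: c_def, intro sum.cong) auto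
  also have "(\<Sum>u\<in>F - {v}. (coord F x u - coord F w u * q) *\<^sub>R u)
      = (\<Sum>u\<in>F. (coord F x u - coord F w u * q) *\<^sub>R u)"
    using fin v nz by (simp add: sum.remove[of F v] q_def)
  also have "\<dots> = x - q *\<^sub>R w"
  proof -
    have "(\<Sum>u\<in>F. (coord F x u - coord F w u * q) *\<^sub>R u)
        = (\<Sum>u\<in>F. coord F x u *\<^sub>R u) - q *\<^sub>R (\<Sum>u\<in>F. coord F w u *\<^sub>R u)"
      by (simp add: scaleR_diff_left sum_subtractf scaleR_sum_right mult.commute)
    then show ?thesis by (simp add: coord_sum[OF F])
  qed
  finally have x: "x = (\<Sum>u\<in>insert w (F - {v}). c u *\<^sub>R u)" by simp
  note un = coord_unique[OF is_basisD(1,3)[OF G] x]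
  show "coord (insert w (F - {v})) x w = coord F x v / coord F w v"
    using un[of w] by (simp add: c_def q_def)
  show "coord (insert w (F - {v})) x u = coord F x u - coord F w u * (coord F x v / coord F w v)"
    if "u \<in> F - {v}" for u
    using un[of u] that w by (auto simp: c_def q_def)
qed

section \<open>Generic walks through a family of cones\<close>

text \<open>First order criterion for a short step from z in direction d to stay in the cone:
  positive coordinates survive by continuity, vanishing ones must not decrease.\<close>

lemma eventually_in_pos:
  assumes F: "is_basis F"
    and "\<And>v. v \<in> F \<Longrightarrow> 0 < coord F z v \<or> 0 = coord F z v \<and> 0 \<le> coord F d v"
  shows "\<forall>\<^sub>F e in at_right (0::real). z + e *\<^sub>R d \<in> pos F"
proof -
  have "\<forall>\<^sub>F e in at_right (0::real). \<forall>v\<in>F. 0 \<le> coord F (z + e *\<^sub>R d) v"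
  proof (rule eventually_ball_finite[OF is_basisD(3)[OF F]], safe)
    fix v assume "v \<in> F"
    from assms(2)[OF this] show "\<forall>\<^sub>F e in at_right 0. 0 \<le> coord F (z + e *\<^sub>R d) v"
    proof
      assume p: "0 < coord F z v"
      have "((\<lambda>e. coord F z v + e * coord F d v) \<longlongrightarrow> coord F z v + 0 * coord F d v) (at_right 0)"
        by (intro tendsto_intros)
      then have "\<forall>\<^sub>F e in at_right 0. 0 < coord F z v + e * coord F d v"
        using p by (intro order_tendstoD) auto
      then show ?thesis
        by eventually_elim (simp add: coord_linear[OF F])
    next
      assume "0 = coord F z v \<and> 0 \<le> coord F d v"
      then show ?thesis
        by (intro eventually_at_rightI[of 0 1]) (auto simp: coord_linear[OF F])
    qed
  qed
  then show ?thesis by eventually_elim (simp add: pos_iff_coord[OF F])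
qed

text \<open>A measure argument: the open cone over a basis is not negligible, while finitely many
  sets of smaller dimension are.\<close>

lemma exists_pos_generic:
  fixes F0 :: "'a::euclidean_space set"
  assumes F0: "is_basis F0" and fin: "finite \<H>"
    and low: "\<And>H. H \<in> \<H> \<Longrightarrow> dim H < DIM('a)"
  obtains x where "x \<in> pos F0" "x \<notin> \<Union>\<H>"
proof -
  define U where "U = (\<Inter>v\<in>F0. {x. 0 < coord F0 x v})"
  have "open U"
    unfolding U_def using is_basisD(3)[OF F0]
    by (auto intro!: open_INT open_Collect_less continuous_coord[OF F0])
  moreover have "(\<Sum>v\<in>F0. 1 *\<^sub>R v) \<in> U"
    using coord_unique[OF is_basisD(1,3)[OF F0], of "\<Sum>v\<in>F0. v" "\<lambda>_. 1"] by (auto simp: U_def)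
  ultimately have "\<not> negligible U" using open_not_negligible by blast
  moreover have "negligible (\<Union>\<H>)"
    using fin low by (intro negligible_Union) (auto intro: negligible_lowdim)
  ultimately obtain x where "x \<in> U" "x \<notin> \<Union>\<H>" using negligible_subset by blast
  then show ?thesis
    by (intro that[of x]) (auto simp: U_def pos_iff_coord[OF F0] intro: less_imp_le)
qed

text \<open>A segment to y that meets the span of \<open>F - {v, w}\<close> before its end starts in
  the span considered here, so starting points outside these small subspaces avoid all faces of
  codimension two.\<close>

lemma dim_insert_ridge:
  fixes F :: "'a::euclidean_space set"
  assumes "is_basis F" "v \<in> F" "w \<in> F" "v \<noteq> w"
  shows "dim (span (insert y (F - {v, w}))) < DIM('a)"
proof -
  have f: "finite F" "card F = DIM('a)" using is_basisD[OF assms(1)] by auto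
  have "card {v, w} \<le> card F" using assms f by (intro card_mono) auto
  then have ge: "2 \<le> card F" using assms by simp
  have "card (F - {v, w}) = card F - 2" using assms f by (subst card_Diff_subset) auto
  then have "card (insert y (F - {v, w})) \<le> card F - 2 + 1"
    by (metis Suc_eq_plus1 card_insert_le_m1 f(1) finite_Diff card_insert_if Suc_n_not_le_n nat_le_linear le_SucI)
  then have "card (insert y (F - {v, w})) < DIM('a)" using ge f by linarith
  moreover have "dim (insert y (F - {v, w})) \<le> card (insert y (F - {v, w}))"
    using f by (intro dim_le_card') auto
  ultimately show ?thesis by (simp add: dim_span)
qed

text \<open>A generic segment that ends in \<open>y\<close> meets each cone boundary only in relative interiors of
  facets, and the crossing hypothesis then prevents it from leaving the union of the cones.\<close>

lemma pos_cover_crossing: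
  fixes A :: "'a::euclidean_space set set"
  assumes fin: "finite A" and ne: "A \<noteq> {}" and bas: "\<And>F. F \<in> A \<Longrightarrow> is_basis F"
    and cross: "\<And>F v. F \<in> A \<Longrightarrow> v \<in> F \<Longrightarrow> coord F y v < 0 \<Longrightarrow>
      \<exists>w. w \<notin> F \<and> insert w (F - {v}) \<in> A \<and> coord F w v < 0"
  shows "\<exists>F\<in>A. y \<in> pos F"
proof -
  \<comment> \<open>The starting points to avoid: those from which the segment to y could meet a
    codimension-two face of a cone before reaching y.\<close>
  define \<H> where "\<H> = (\<Union>F\<in>A. (\<lambda>(v, w). span (insert y (F - {v, w}))) ` {(v, w). v \<in> F \<and> w \<in> F \<and> v \<noteq> w})"
  have "finite {(v, w). v \<in> F \<and> w \<in> F \<and> v \<noteq> w}" if "F \<in> A" for F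
    by (rule finite_subset[of _ "F \<times> F"]) (use is_basisD(3)[OF bas[OF that]] in auto)
  then have "finite \<H>" unfolding \<H>_def using fin by auto
  moreover have "dim H < DIM('a)" if "H \<in> \<H>" for H
    using that dim_insert_ridge[OF bas] unfolding \<H>_def by fastforce
  moreover obtain F0 where F0: "F0 \<in> A" using ne by blast
  ultimately obtain x where x: "x \<in> pos F0" "x \<notin> \<Union>\<H>"
    using exists_pos_generic[OF bas[OF F0]] by metis
  define d where "d = y - x"
  define s where "s t = x + t *\<^sub>R d" for t
  define C where "C = (\<Union>F\<in>A. pos F)"
  have clC: "closed C" unfolding C_def using fin bas closed_pos by (intro closed_UN) auto
  have conts: "continuous_on UNIV s" unfolding s_def by (intro continuous_intros)
  define I where "I = {0..1} \<inter> s -` C"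
  have "closed (s -` C)" using continuous_closed_vimage[of C s] clC conts
    by (metis continuous_on_eq_continuous_at open_UNIV UNIV_I)
  then have "compact I" unfolding I_def by (intro compact_Int_closed) auto
  moreover have "0 \<in> I" unfolding I_def C_def s_def using x F0 by auto
  \<comment> \<open>The last time at which the segment is in the union of the cones.\<close>
  ultimately obtain t where t: "t \<in> I" and tmax: "\<And>t'. t' \<in> I \<Longrightarrow> t' \<le> t"
    using compact_attains_sup[of I] by blast
  show ?thesis
  proof (cases "t = 1")
    case True
    then show ?thesis using t by (auto simp: I_def C_def s_def d_def)
  next
    case False
    then have t01: "0 \<le> t" "t < 1" using t by (auto simp: I_def)
    define z where "z = s t"
    have leave: "\<not> (\<forall>\<^sub>F e in at_right (0::real). z + e *\<^sub>R d \<in> pos F)" if "F \<in> A" for F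
    proof
      assume "\<forall>\<^sub>F e in at_right (0::real). z + e *\<^sub>R d \<in> pos F"
      moreover have "\<forall>\<^sub>F e in at_right (0::real). e \<in> {0<..<1 - t}"
        using t01 by (intro eventually_at_right_real) auto
      ultimately have "\<forall>\<^sub>F e in at_right (0::real). False"
      proof eventually_elim
        case (elim e)
        have "z + e *\<^sub>R d = s (t + e)" by (simp add: z_def s_def algebra_simps)
        then have "t + e \<in> I" using elim that t01 by (auto simp: I_def C_def)
        then show ?case using tmax[of "t + e"] elim by auto
      qed
      then show False by (simp add: trivial_limit_at_right_real)
    qed
    obtain F where F: "F \<in> A" "z \<in> pos F" using t by (auto simp: I_def C_def z_def)
    note bF = bas[OF F(1)]
    have zc: "0 \<le> coord F z u" if "u \<in> F" for u using F(2) that by (simp add: pos_iff_coord[OF bF])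
    \<comment> \<open>Genericity: two vanishing coordinates would put z in a codimension-two face,
      and x is a combination of z and y because z = (1 - t) x + t y with t < 1.\<close>
    have one: "u = v" if "u \<in> F" "v \<in> F" "coord F z u = 0" "coord F z v = 0" for u v
    proof (rule ccontr)
      assume "u \<noteq> v"
      let ?H = "span (insert y (F - {u, v}))"
      have "?H \<in> \<H>" unfolding \<H>_def using F(1) that \<open>u \<noteq> v\<close> by force
      have "(\<Sum>i\<in>F - {u, v}. coord F z i *\<^sub>R i) = (\<Sum>i\<in>F. coord F z i *\<^sub>R i)"
        using that is_basisD(3)[OF bF] by (intro sum.mono_neutral_left) auto
      then have "z = (\<Sum>i\<in>F - {u, v}. coord F z i *\<^sub>R i)"
        by (simp add: coord_sum[OF bF])
      also have "\<dots> \<in> ?H" by (intro span_sum span_scale span_base) auto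
      finally have "z - t *\<^sub>R y \<in> ?H" by (intro span_diff span_scale[of y] span_base[of y]) auto
      then have "(1 / (1 - t)) *\<^sub>R (z - t *\<^sub>R y) \<in> ?H" by (rule span_scale)
      moreover have "z - t *\<^sub>R y = (1 - t) *\<^sub>R x" by (simp add: z_def s_def d_def algebra_simps)
      ultimately have "x \<in> ?H" using t01 by simp
      then show False using x(2) \<open>?H \<in> \<H>\<close> by blast
    qed
    obtain v where v: "v \<in> F" "coord F z v = 0" "coord F d v < 0"
    proof -
      have "\<not> (\<forall>v\<in>F. 0 < coord F z v \<or> 0 = coord F z v \<and> 0 \<le> coord F d v)"
        using leave[OF F(1)] eventually_in_pos[OF bF] by blast
      then show ?thesis using zc that by (metis less_le not_le)
    qed
    \<comment> \<open>The coordinate of z at v is 0, so y and d have coordinates of the same sign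
      there; this makes the crossing hypothesis for y applicable at the wall through z.\<close>
    have "y = z + (1 - t) *\<^sub>R d" by (simp add: z_def s_def d_def algebra_simps)
    then have "coord F y v = (1 - t) * coord F d v" using v by (simp add: coord_linear[OF bF])
    also have "\<dots> < 0" using v t01 by (simp add: mult_less_0_iff)
    finally obtain w where w: "w \<notin> F" "insert w (F - {v}) \<in> A" "coord F w v < 0"
      using cross[OF F(1) v(1)] by blast
    let ?G = "insert w (F - {v})"
    note ex = coord_exchange[OF bF v(1) w(1) bas[OF w(2)] less_imp_neq[OF w(3)]]
    \<comment> \<open>Beyond the wall the coordinate of d at w is a quotient of two negative
      numbers, and the other coordinates of z are unchanged and positive, since only the one at v
      vanishes.\<close>
    have "\<forall>\<^sub>F e in at_right (0::real). z + e *\<^sub>R d \<in> pos ?G"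
    proof (rule eventually_in_pos[OF bas[OF w(2)]])
      fix u assume "u \<in> ?G"
      then consider "u = w" | "u \<in> F - {v}" by blast
      then show "0 < coord ?G z u \<or> 0 = coord ?G z u \<and> 0 \<le> coord ?G d u"
      proof cases
        case 1
        then show ?thesis using ex(1)[of z] ex(1)[of d] v w(3)
          by (simp add: divide_nonpos_nonpos less_imp_le)
      next
        case 2
        then have "coord F z u \<noteq> 0" using one v by blast
        then show ?thesis using 2 ex(2)[OF 2, of z] v zc[of u] by auto
      qed
    qed
    with leave[OF w(2)] show ?thesis by blast
  qed
qed

text \<open>If w were on the same side of the wall as v, or on its hyperplane, then w plus a large
  multiple of the wall vectors would lie in both cones but not in their common face.\<close>

lemma coord_opposite:
  fixes F :: "'a::euclidean_space set"
  assumes F: "is_basis F" and G: "is_basis (insert w (F - {v}))" and v: "v \<in> F" and w: "w \<notin> F"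
    and Int: "pos F \<inter> pos (insert w (F - {v})) \<subseteq> pos (F \<inter> insert w (F - {v}))"
  shows "coord F w v < 0"
proof (rule ccontr)
  assume "\<not> coord F w v < 0"
  then have wv: "0 \<le> coord F w v" by simp
  note fin = is_basisD(3)[OF F]
  let ?G = "insert w (F - {v})"
  \<comment> \<open>Bounds every coordinate of w in F, so that adding N at the wall vectors makes
    them nonnegative.\<close>
  define N where "N = (\<Sum>u\<in>F. \<bar>coord F w u\<bar>)"
  have N: "\<bar>coord F w u\<bar> \<le> N" if "u \<in> F" for u
    unfolding N_def using that fin by (intro member_le_sum) auto
  have N0: "0 \<le> N" unfolding N_def by (intro sum_nonneg) auto
  define z where "z = w + (\<Sum>u\<in>F - {v}. N *\<^sub>R u)"
  have zG: "z = (\<Sum>u\<in>?G. (if u = w then 1 else N) *\<^sub>R u)"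
  proof -
    have "(\<Sum>u\<in>F - {v}. (if u = w then 1 else N) *\<^sub>R u) = (\<Sum>u\<in>F - {v}. N *\<^sub>R u)"
      using w by (intro sum.cong) auto
    then show ?thesis unfolding z_def using w fin by simp
  qed
  have zF: "z = (\<Sum>u\<in>F. (coord F w u + (if u = v then 0 else N)) *\<^sub>R u)"
  proof -
    have "(\<Sum>u\<in>F - {v}. N *\<^sub>R u) = (\<Sum>u\<in>F. (if u = v then 0 else N) *\<^sub>R u)"
      using fin by (intro sum.mono_neutral_cong_left) auto
    then show ?thesis
      by (simp add: z_def scaleR_add_left sum.distrib coord_sum[OF F])
  qed
  have "z \<in> pos ?G" by (rule posI[OF zG]) (use N0 in auto)
  moreover have "z \<in> pos F"
  proof (rule posI[OF zF])
    fix u assume "u \<in> F"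
    then show "0 \<le> coord F w u + (if u = v then 0 else N)"
      using N[of u] wv by (auto simp: abs_le_iff)
  qed
  moreover have "F \<inter> ?G = F - {v}" using w by auto
  ultimately have "z \<in> pos (F - {v})" using Int by auto
  then obtain c where c: "z = (\<Sum>u\<in>F - {v}. c u *\<^sub>R u)" by (rule posE)
  have "z = (\<Sum>u\<in>?G. (if u = w then 0 else c u) *\<^sub>R u)"
  proof -
    have "(\<Sum>u\<in>F - {v}. (if u = w then 0 else c u) *\<^sub>R u) = (\<Sum>u\<in>F - {v}. c u *\<^sub>R u)"
      using w by (intro sum.cong) auto
    then show ?thesis unfolding c using w fin by simp
  qed
  \<comment> \<open>The two expansions of z in the basis \<open>?G\<close> have coefficients 1 and 0
    at w.\<close>
  from coord_unique[OF is_basisD(1,3)[OF G] zG, of w] coord_unique[OF is_basisD(1,3)[OF G] this, of w]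
  show False by simp
qed

subsection \<open>Simplicial fans\<close>

text \<open>Closure under faces is not demanded, so that the notion covers both all link simplices
  and the facets alone.\<close>

definition simp_fan :: "'a::real_vector set set \<Rightarrow> bool" where
  "simp_fan \<S> \<longleftrightarrow> (\<forall>S\<in>\<S>. finite S \<and> independent S) \<and>
     (\<forall>S\<in>\<S>. \<forall>T\<in>\<S>. pos S \<inter> pos T \<subseteq> pos (S \<inter> T))"

lemma simp_fanD:
  assumes "simp_fan \<S>" "S \<in> \<S>"
  shows "finite S" "independent S" "0 \<notin> S"
    and "T \<in> \<S> \<Longrightarrow> x \<in> pos S \<Longrightarrow> x \<in> pos T \<Longrightarrow> x \<in> pos (S \<inter> T)"
  using assms unfolding simp_fan_def using real_vector.dependent_zero by blast+

text \<open>Only maximal cones are listed. The last clause says that no wall is a boundary wall, the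
  combinatorial substitute for completeness.\<close>

definition closed_fan :: "'a::euclidean_space set set \<Rightarrow> bool" where
  "closed_fan \<F> \<longleftrightarrow> simp_fan \<F> \<and> finite \<F> \<and> \<F> \<noteq> {} \<and> (\<forall>F\<in>\<F>. card F = DIM('a)) \<and>
     (\<forall>F\<in>\<F>. \<forall>v\<in>F. \<exists>w. w \<notin> F \<and> insert w (F - {v}) \<in> \<F>)"

lemma closed_fan_basis: "closed_fan \<F> \<Longrightarrow> F \<in> \<F> \<Longrightarrow> is_basis F"
  by (auto simp: closed_fan_def simp_fan_def is_basis_def)

lemma closed_fan_opposite:
  assumes "closed_fan \<F>" "F \<in> \<F>" "v \<in> F" "w \<notin> F" "insert w (F - {v}) \<in> \<F>"
  shows "coord F w v < 0"
proof (rule coord_opposite[OF closed_fan_basis[OF assms(1,2)] closed_fan_basis[OF assms(1,5)] assms(3,4)])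
  show "pos F \<inter> pos (insert w (F - {v})) \<subseteq> pos (F \<inter> insert w (F - {v}))"
    using assms(1,2,5) unfolding closed_fan_def simp_fan_def by blast
qed

text \<open>The difference of the functionals of two adjacent facets vanishes on their wall, hence
  is a multiple of the coordinate at the replaced vertex v. By \<open>loc\<close> it is nonnegative
  at w, which lies beyond the wall, and so also at y whenever y lies beyond it. Thus the facets that
  maximise at y are closed under crossings towards y.\<close>

lemma closed_fan_support:
  fixes a :: "'a::euclidean_space set \<Rightarrow> 'a"
  assumes cf: "closed_fan \<F>"
    and a: "\<And>F u. F \<in> \<F> \<Longrightarrow> u \<in> F \<Longrightarrow> a F \<bullet> u = 1"
    and loc: "\<And>F v w. F \<in> \<F> \<Longrightarrow> v \<in> F \<Longrightarrow> w \<notin> F \<Longrightarrow> insert w (F - {v}) \<in> \<F> \<Longrightarrow> a F \<bullet> w \<le> 1"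
  shows "\<exists>F\<in>\<F>. y \<in> pos F \<and> (\<forall>G\<in>\<F>. a G \<bullet> y \<le> a F \<bullet> y)"
proof -
  define A where "A = {F\<in>\<F>. \<forall>G\<in>\<F>. a G \<bullet> y \<le> a F \<bullet> y}"
  have fin: "finite \<F>" and ne: "\<F> \<noteq> {}" using cf by (auto simp: closed_fan_def)
  have "\<exists>F\<in>A. y \<in> pos F"
  proof (rule pos_cover_crossing)
    show "finite A" using fin by (simp add: A_def)
    show "A \<noteq> {}"
    proof -
      have "Max ((\<lambda>F. a F \<bullet> y) ` \<F>) \<in> (\<lambda>F. a F \<bullet> y) ` \<F>" using fin ne by (intro Max_in) auto
      then obtain F where "F \<in> \<F>" "a F \<bullet> y = Max ((\<lambda>F. a F \<bullet> y) ` \<F>)" by auto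
      then have "F \<in> A" using fin by (auto simp: A_def)
      then show ?thesis by blast
    qed
    show "is_basis F" if "F \<in> A" for F using that closed_fan_basis[OF cf] by (simp add: A_def)
    fix F v assume FA: "F \<in> A" and v: "v \<in> F" and neg: "coord F y v < 0"
    have F: "F \<in> \<F>" using FA by (simp add: A_def)
    note bF = closed_fan_basis[OF cf F]
    obtain w where w: "w \<notin> F" "insert w (F - {v}) \<in> \<F>"
      using cf F v unfolding closed_fan_def by blast
    have wneg: "coord F w v < 0" by (rule closed_fan_opposite[OF cf F v w])
    let ?G = "insert w (F - {v})"
    define b where "b = a ?G - a F"
    have bx: "b \<bullet> x = coord F x v * (b \<bullet> v)" for x
    proof -
      have "b \<bullet> x = (\<Sum>u\<in>F. coord F x u * (b \<bullet> u))"
        by (subst coord_sum[OF bF, of x, symmetric]) (simp add: inner_sum_right)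
      also have "\<dots> = (\<Sum>u\<in>{v}. coord F x u * (b \<bullet> u))"
        using v is_basisD(3)[OF bF] a[OF F] a[OF w(2)]
        by (intro sum.mono_neutral_right) (auto simp: b_def inner_diff_left)
      finally show ?thesis by simp
    qed
    have "0 \<le> b \<bullet> w" using a[OF w(2), of w] loc[OF F v w] by (simp add: b_def inner_diff_left)
    then have "b \<bullet> v \<le> 0" using bx[of w] wneg by (simp add: zero_le_mult_iff)
    then have "0 \<le> b \<bullet> y" using bx[of y] neg by (simp add: zero_le_mult_iff)
    then have "?G \<in> A" using FA w(2) by (force simp: A_def b_def inner_diff_left)
    then show "\<exists>w. w \<notin> F \<and> insert w (F - {v}) \<in> A \<and> coord F w v < 0" using w wneg by blast
  qed
  then show ?thesis by (auto simp: A_def)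
qed

lemma closed_fan_complete:
  assumes cf: "closed_fan \<F>" shows "\<exists>F\<in>\<F>. y \<in> pos F"
proof (rule pos_cover_crossing)
  show "finite \<F>" "\<F> \<noteq> {}" using cf by (auto simp: closed_fan_def)
  show "is_basis F" if "F \<in> \<F>" for F using closed_fan_basis[OF cf that] .
  fix F v assume "F \<in> \<F>" "v \<in> F"
  then show "\<exists>w. w \<notin> F \<and> insert w (F - {v}) \<in> \<F> \<and> coord F w v < 0"
    using closed_fan_opposite[OF cf] cf unfolding closed_fan_def by metis
qed

section \<open>Hulls and cones of a fan\<close>

text \<open>Coefficients over the independent set S are unique, so those outside T vanish. That
  their sum is preserved transfers the conditions "sum is 1" and "sum is at most 1" which cut the
  two kinds of hull out of the cone.\<close>

lemma simp_fan_expansion: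
  assumes fan: "simp_fan \<S>" "S \<in> \<S>" "T \<in> \<S>"
    and x: "x = (\<Sum>v\<in>S. c v *\<^sub>R v)" "\<And>v. v \<in> S \<Longrightarrow> 0 \<le> c v" "x \<in> pos T"
  shows "x = (\<Sum>v\<in>S \<inter> T. c v *\<^sub>R v)" "sum c (S \<inter> T) = sum c S"
proof -
  note S = simp_fanD(1,2)[OF fan(1,2)]
  have "x \<in> pos S" by (rule posI[OF x(1,2)])
  then obtain e where e: "x = (\<Sum>v\<in>S \<inter> T. e v *\<^sub>R v)"
    using simp_fanD(4)[OF fan _ x(3)] by (metis posE)
  have "(\<Sum>v\<in>S \<inter> T. e v *\<^sub>R v) = (\<Sum>v\<in>S. (if v \<in> T then e v else 0) *\<^sub>R v)"
    using S by (intro sum.mono_neutral_cong_left) auto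
  then have x': "x = (\<Sum>v\<in>S. (if v \<in> T then e v else 0) *\<^sub>R v)" using e by simp
  have c: "c v = (if v \<in> T then e v else 0)" if "v \<in> S" for v
    using coord_unique[OF S(2,1) x(1) that] coord_unique[OF S(2,1) x' that] by simp
  show "x = (\<Sum>v\<in>S \<inter> T. c v *\<^sub>R v)"
    unfolding e using c by (intro sum.cong) auto
  show "sum c (S \<inter> T) = sum c S"
    using S c by (intro sum.mono_neutral_left) auto
qed

lemma simp_fan_hull_Int:
  assumes fan: "simp_fan \<S>" "S \<in> \<S>" "T \<in> \<S>"
  shows "convex hull S \<inter> convex hull T = convex hull (S \<inter> T)"
proof
  have fin: "finite S" "finite T" using simp_fanD(1)[OF fan(1)] fan(2,3) by auto
  show "convex hull S \<inter> convex hull T \<subseteq> convex hull (S \<inter> T)"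
  proof
    fix x assume x: "x \<in> convex hull S \<inter> convex hull T"
    then obtain c where c: "\<forall>v\<in>S. 0 \<le> c v" "sum c S = 1" "x = (\<Sum>v\<in>S. c v *\<^sub>R v)"
      by (auto simp: convex_hull_finite[OF fin(1)])
    have "x \<in> pos T" using x fin(2) by (auto simp: convex_hull_finite[OF fin(2)] intro: posI)
    from simp_fan_expansion[OF fan c(3) c(1)[rule_format] this] show "x \<in> convex hull (S \<inter> T)"
      using c fin by (subst convex_hull_finite) auto
  qed
qed (simp add: hull_mono)

lemma hull_insert_0:
  assumes "finite S" "0 \<notin> S"
  shows "convex hull (insert 0 S) = {\<Sum>v\<in>S. c v *\<^sub>R v | c. (\<forall>v\<in>S. 0 \<le> c v) \<and> sum c S \<le> 1}"
proof (intro set_eqI iffI)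
  fix x assume "x \<in> convex hull (insert 0 S)"
  then obtain c where c: "\<forall>v\<in>insert 0 S. 0 \<le> c v" "sum c (insert 0 S) = 1"
      "(\<Sum>v\<in>insert 0 S. c v *\<^sub>R v) = x"
    using assms(1) by (simp add: convex_hull_finite[of "insert 0 S"] del: sum.insert) blast
  then have "x = (\<Sum>v\<in>S. c v *\<^sub>R v)" "\<forall>v\<in>S. 0 \<le> c v" "sum c S \<le> 1"
    using assms by simp_all
  then show "x \<in> {\<Sum>v\<in>S. c v *\<^sub>R v | c. (\<forall>v\<in>S. 0 \<le> c v) \<and> sum c S \<le> 1}"
    by blast
next
  fix x assume "x \<in> {\<Sum>v\<in>S. c v *\<^sub>R v | c. (\<forall>v\<in>S. 0 \<le> c v) \<and> sum c S \<le> 1}"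
  then obtain c where c: "x = (\<Sum>v\<in>S. c v *\<^sub>R v)" "\<forall>v\<in>S. 0 \<le> c v" "sum c S \<le> 1" by auto
  \<comment> \<open>The apex 0 receives the weight missing to 1.\<close>
  define c' where "c' v = (if v = 0 then 1 - sum c S else c v)" for v
  have e: "sum c' S = sum c S" "(\<Sum>v\<in>S. c' v *\<^sub>R v) = (\<Sum>v\<in>S. c v *\<^sub>R v)"
    using assms by (auto simp: c'_def intro!: sum.cong)
  show "x \<in> convex hull (insert 0 S)"
    using assms c e by (subst convex_hull_finite) (auto intro!: exI[of _ c'] simp: c'_def)
qed

lemma hull_insert_0_subset_pos:
  "finite S \<Longrightarrow> 0 \<notin> S \<Longrightarrow> convex hull (insert 0 S) \<subseteq> pos S"
  by (auto simp: hull_insert_0 pos_def)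

lemma simp_fan_hull_insert_Int:
  assumes fan: "simp_fan \<S>" "S \<in> \<S>" "T \<in> \<S>"
  shows "convex hull insert 0 S \<inter> convex hull insert 0 T = convex hull insert 0 (S \<inter> T)"
proof
  note S = simp_fanD(1,3)[OF fan(1,2)] and T = simp_fanD(1,3)[OF fan(1,3)]
  show "convex hull insert 0 S \<inter> convex hull insert 0 T \<subseteq> convex hull insert 0 (S \<inter> T)"
  proof
    fix x assume x: "x \<in> convex hull insert 0 S \<inter> convex hull insert 0 T"
    then obtain c where c: "\<And>v. v \<in> S \<Longrightarrow> 0 \<le> c v" "sum c S \<le> 1" "x = (\<Sum>v\<in>S. c v *\<^sub>R v)"
      by (auto simp: hull_insert_0[OF S])
    have "x \<in> pos T" using x hull_insert_0_subset_pos[OF T] by blast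
    from simp_fan_expansion[OF fan c(3,1) this] show "x \<in> convex hull insert 0 (S \<inter> T)"
      using c S by (subst hull_insert_0) (auto intro!: exI[of _ c])
  qed
qed (auto intro!: hull_mono)

text \<open>A sum of nonnegative coefficients vanishes only if all of them do; otherwise it is the
  scale that projects the point to the simplex.\<close>

lemma pos_scaled_hull:
  assumes "finite S" "x \<in> pos S"
  obtains "x = 0" | k where "0 < k" "(1 / k) *\<^sub>R x \<in> convex hull S"
proof -
  obtain c where c: "x = (\<Sum>v\<in>S. c v *\<^sub>R v)" "\<And>v. v \<in> S \<Longrightarrow> 0 \<le> c v" using assms by (metis posE)
  consider "sum c S = 0" | "0 < sum c S" using c(2) by (metis sum_nonneg order_le_less)
  then show ?thesis
  proof cases
    case 1
    then have "\<forall>v\<in>S. c v = 0" using c(2) assms(1) by (simp add: sum_nonneg_eq_0_iff)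
    then show ?thesis using c that by simp
  next
    case 2
    have "(1 / sum c S) *\<^sub>R x \<in> convex hull S"
      unfolding convex_hull_finite[OF assms(1)] using 2 c
      by (auto intro!: exI[of _ "\<lambda>v. c v / sum c S"] simp: scaleR_sum_right sum_divide_distrib[symmetric])
    then show ?thesis using that 2 by blast
  qed
qed

lemma hull_subset_pos: "finite S \<Longrightarrow> convex hull S \<subseteq> pos S"
  by (auto simp: convex_hull_finite pos_def)

text \<open>A nonzero point of two cones projects to both simplices along its ray. By
  \<open>radial\<close> the two projections coincide, so the intersection of cones reduces to that
  of hulls.\<close>

lemma simp_fan_radial:
  assumes ind: "\<And>S. S \<in> \<S> \<Longrightarrow> finite S \<and> independent S"
    and Int: "\<And>S T. S \<in> \<S> \<Longrightarrow> T \<in> \<S> \<Longrightarrow> convex hull S \<inter> convex hull T \<subseteq> convex hull (S \<inter> T)"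
    and radial: "\<And>S T x t. S \<in> \<S> \<Longrightarrow> T \<in> \<S> \<Longrightarrow> x \<in> convex hull S \<Longrightarrow> 0 < t \<Longrightarrow>
      t *\<^sub>R x \<in> convex hull T \<Longrightarrow> t = 1"
  shows "simp_fan \<S>"
  unfolding simp_fan_def
proof (intro conjI ballI subsetI)
  fix S T x assume S: "S \<in> \<S>" and T: "T \<in> \<S>" and x: "x \<in> pos S \<inter> pos T"
  have fin: "finite S" "finite T" using ind S T by auto
  show "x \<in> pos (S \<inter> T)"
  proof (cases "x = 0")
    case True
    then show ?thesis by (simp add: zero_in_pos)
  next
    case False
    obtain k where k: "0 < k" "(1 / k) *\<^sub>R x \<in> convex hull S"
      using pos_scaled_hull[OF fin(1), of x] x False by blast
    obtain m where m: "0 < m" "(1 / m) *\<^sub>R x \<in> convex hull T"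
      using pos_scaled_hull[OF fin(2), of x] x False by blast
    have "k / m = 1" by (rule radial[OF S T k(2)]) (use k m in auto)
    then have "k = m" using m by simp
    then have "(1 / k) *\<^sub>R x \<in> convex hull (S \<inter> T)" using Int[OF S T] k m by blast
    then have "(1 / k) *\<^sub>R x \<in> pos (S \<inter> T)" using hull_subset_pos[of "S \<inter> T"] fin by blast
    from pos_scale[OF this, of k] show ?thesis using k by simp
  qed
qed (use ind in auto)

subsection \<open>Inversion\<close>

text \<open>The parameter r is the square of the radius of the sphere. Division by zero makes the
  centre 0 a fixed point, so the map is an involution on the whole space when r is positive.\<close>

definition inversion :: "real \<Rightarrow> 'a::real_inner \<Rightarrow> 'a" where
  "inversion r x = (r / (norm x)\<^sup>2) *\<^sub>R x"

lemma inversion_0 [simp]: "inversion r 0 = 0"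
  by (simp add: inversion_def)

lemma inversion_eq_0_iff [simp]: "0 < r \<Longrightarrow> inversion r x = 0 \<longleftrightarrow> x = 0"
  by (simp add: inversion_def)

lemma inversion_inversion [simp]:
  assumes "0 < r" shows "inversion r (inversion r x) = x"
  using assms by (cases "x = 0") (simp_all add: inversion_def power2_eq_square field_simps)

lemma inj_inversion: "0 < r \<Longrightarrow> inj_on (inversion r) S"
  by (metis inj_onI inversion_inversion)

lemma dist_inversion:
  assumes "0 < r" "x \<noteq> 0" "y \<noteq> 0"
  shows "dist (inversion r x) (inversion r y) = r * dist x y / (norm x * norm y)"
proof (rule power2_eq_imp_eq)
  have n: "norm x ^ 2 = x \<bullet> x" "norm y ^ 2 = y \<bullet> y" by (simp_all add: power2_norm_eq_inner)
  have nz: "x \<bullet> x \<noteq> 0" "y \<bullet> y \<noteq> 0" using assms by auto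
  have J: "inversion r x = (r / (x \<bullet> x)) *\<^sub>R x" "inversion r y = (r / (y \<bullet> y)) *\<^sub>R y"
    by (simp_all add: inversion_def n)
  have "(dist (inversion r x) (inversion r y))\<^sup>2 = (inversion r x - inversion r y) \<bullet> (inversion r x - inversion r y)"
    by (simp add: dist_norm power2_norm_eq_inner)
  also have "\<dots> = r\<^sup>2 * ((x - y) \<bullet> (x - y)) / ((x \<bullet> x) * (y \<bullet> y))"
    using nz unfolding J
    by (simp add: inner_diff_left inner_diff_right inner_commute[of y x] field_simps power2_eq_square)
  also have "\<dots> = (r * dist x y / (norm x * norm y))\<^sup>2"
    by (simp add: power_divide power_mult_distrib n dist_norm power2_norm_eq_inner)
  finally show "(dist (inversion r x) (inversion r y))\<^sup>2 = (r * dist x y / (norm x * norm y))\<^sup>2" .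
qed (use assms in auto)

text \<open>Inversion sends spheres through the origin to hyperplanes, so an empty circumball becomes a
  supporting half space.\<close>

lemma sphere_inversion:
  fixes c x :: "'a::real_inner"
  assumes "0 < r" "x \<noteq> 0"
  shows "dist c x < norm c \<longleftrightarrow> 1 < ((2 / r) *\<^sub>R c) \<bullet> inversion r x"
    and "dist c x = norm c \<longleftrightarrow> ((2 / r) *\<^sub>R c) \<bullet> inversion r x = 1"
proof -
  have p: "0 < x \<bullet> x" using assms by simp
  have d: "(dist c x)\<^sup>2 = (norm c)\<^sup>2 - 2 * (c \<bullet> x) + x \<bullet> x"
    by (simp add: dist_norm power2_norm_eq_inner inner_diff_left inner_diff_right inner_commute)
  \<comment> \<open>The factor 2 / r cancels the r of the inversion and puts the image of the sphere
    at level 1.\<close>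
  have i: "((2 / r) *\<^sub>R c) \<bullet> inversion r x = 2 * (c \<bullet> x) / (x \<bullet> x)"
    using assms by (simp add: inversion_def power2_norm_eq_inner)
  have "dist c x < norm c \<longleftrightarrow> (dist c x)\<^sup>2 < (norm c)\<^sup>2"
    by (metis norm_ge_zero power_less_imp_less_base power_strict_mono zero_le_dist zero_less_numeral)
  also have "\<dots> \<longleftrightarrow> 1 < 2 * (c \<bullet> x) / (x \<bullet> x)" unfolding d using p by (auto simp: less_divide_eq)
  finally show "dist c x < norm c \<longleftrightarrow> 1 < ((2 / r) *\<^sub>R c) \<bullet> inversion r x" unfolding i .
  have "dist c x = norm c \<longleftrightarrow> (dist c x)\<^sup>2 = (norm c)\<^sup>2"
    by (metis norm_ge_zero power2_eq_imp_eq zero_le_dist)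
  also have "\<dots> \<longleftrightarrow> 2 * (c \<bullet> x) / (x \<bullet> x) = 1" unfolding d using p by (auto simp: divide_eq_eq)
  finally show "dist c x = norm c \<longleftrightarrow> ((2 / r) *\<^sub>R c) \<bullet> inversion r x = 1" unfolding i .
qed

text \<open>Positive factors can be absorbed into the coefficients. Inversion is such a rescaling,
  with a factor that varies from vector to vector.\<close>

lemma pos_rescaled:
  assumes "inj_on h S" "\<And>x. x \<in> S \<Longrightarrow> h x = s x *\<^sub>R x" "\<And>x. x \<in> S \<Longrightarrow> (0::real) < s x"
  shows "pos (h ` S) = pos S"
proof -
  have e: "(\<Sum>v\<in>h ` S. c v *\<^sub>R v) = (\<Sum>v\<in>S. (c (h v) * s v) *\<^sub>R v)" for c
    unfolding sum.reindex[OF assms(1)] o_def by (intro sum.cong) (simp_all add: assms(2))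
  show ?thesis
  proof (intro set_eqI iffI)
    fix x assume "x \<in> pos (h ` S)"
    then show "x \<in> pos S"
    proof (rule posE)
      fix c assume "x = (\<Sum>v\<in>h ` S. c v *\<^sub>R v)" "\<And>v. v \<in> h ` S \<Longrightarrow> 0 \<le> c v"
      then show ?thesis
        unfolding e using assms(3) by (intro posI) (auto intro!: mult_nonneg_nonneg intro: less_imp_le)
    qed
  next
    fix x assume "x \<in> pos S"
    then obtain c where c: "x = (\<Sum>v\<in>S. c v *\<^sub>R v)" "\<And>v. v \<in> S \<Longrightarrow> 0 \<le> c v" by (rule posE) blast
    define g where "g = the_inv_into S h"
    have g: "g (h v) = v" if "v \<in> S" for v 
      unfolding g_def by (rule the_inv_into_f_f[OF assms(1) that])
    have cs: "c v = c (g (h v)) / s (g (h v)) * s v" if "v \<in> S" for v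
      using g[OF that] assms(3)[OF that] by simp
    show "x \<in> pos (h ` S)"
    proof (rule posI)
      show "x = (\<Sum>v\<in>h ` S. (c (g v) / s (g v)) *\<^sub>R v)"
        unfolding e c(1) by (intro sum.cong refl) (simp only: cs[symmetric])
    qed (use c g assms(3) in \<open>auto simp: less_imp_le\<close>)
  qed
qed

lemma independent_rescaled:
  assumes "inj_on h S" "\<And>x. x \<in> S \<Longrightarrow> h x = s x *\<^sub>R x" "\<And>x. x \<in> S \<Longrightarrow> (0::real) < s x"
    and "finite S" "independent S"
  shows "independent (h ` S)"
proof
  assume "dependent (h ` S)"
  then obtain c where c: "\<exists>v\<in>h ` S. c v \<noteq> 0" "(\<Sum>v\<in>h ` S. c v *\<^sub>R v) = 0"
    using assms(4) by (auto simp: real_vector.dependent_finite)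
  have "(\<Sum>v\<in>S. (c (h v) * s v) *\<^sub>R v) = (\<Sum>v\<in>h ` S. c v *\<^sub>R v)"
    unfolding sum.reindex[OF assms(1)] o_def by (intro sum.cong) (simp_all add: assms(2))
  then have "(\<Sum>v\<in>S. (c (h v) * s v) *\<^sub>R v) = 0" using c by simp
  moreover have "\<exists>v\<in>S. c (h v) * s v \<noteq> 0" using c(1) assms(3) by (auto simp: less_imp_neq[symmetric])
  ultimately have "dependent S" using real_vector.dependent_finite[OF assms(4)] by metis
  then show False using assms(5) by blast
qed

lemma inversion_rescales:
  assumes "0 < r" "independent S" "x \<in> S"
  shows "inversion r x = (r / (norm x)\<^sup>2) *\<^sub>R x" "0 < r / (norm x)\<^sup>2"
proof -
  have "x \<noteq> 0" using assms real_vector.dependent_zero by blast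
  then show "0 < r / (norm x)\<^sup>2" using assms(1) by simp
qed (simp add: inversion_def)

lemma pos_inversion: "0 < r \<Longrightarrow> independent S \<Longrightarrow> pos (inversion r ` S) = pos S"
  by (rule pos_rescaled[where s = "\<lambda>x. r / (norm x)\<^sup>2"]) (simp_all add: inj_inversion inversion_rescales)

text \<open>Inversion moves each vertex along its own ray, so every cone stays the same set, and
  injectivity carries over the intersections of vertex sets.\<close>

lemma simp_fan_inversion:
  assumes r: "0 < r" and fan: "simp_fan \<S>"
  shows "simp_fan ((`) (inversion r) ` \<S>)"
  unfolding simp_fan_def
proof (intro conjI ballI)
  fix S' assume "S' \<in> (`) (inversion r) ` \<S>"
  then obtain S where S: "S \<in> \<S>" "S' = inversion r ` S" by auto
  note fS = simp_fanD[OF fan S(1)]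
  show "finite S'" using S fS by simp
  show "independent S'" unfolding S(2)
    by (rule independent_rescaled[OF inj_inversion inversion_rescales]) (use r fS in auto)
  fix T' assume "T' \<in> (`) (inversion r) ` \<S>"
  then obtain T where T: "T \<in> \<S>" "T' = inversion r ` T" by auto
  note fT = simp_fanD[OF fan T(1)]
  have "S' \<inter> T' = inversion r ` (S \<inter> T)"
    unfolding S T by (rule image_Int[OF inj_inversion[OF r], symmetric])
  moreover have "independent (S \<inter> T)" using fS(2) by (rule real_vector.independent_mono) auto
  ultimately show "pos S' \<inter> pos T' \<subseteq> pos (S' \<inter> T')"
    using fS fT T r by (auto simp: S T pos_inversion)
qed

subsection \<open>Fans and geometric complexes\<close>

text \<open>A whole interval of factors is provided, so that two cones containing x have an
  admissible factor in common.\<close>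

lemma pos_scaled_insert_0:
  assumes "finite S" "0 \<notin> S" "x \<in> pos S"
  obtains d where "0 < d" "\<And>e. 0 \<le> e \<Longrightarrow> e \<le> d \<Longrightarrow> e *\<^sub>R x \<in> convex hull insert 0 S"
proof -
  obtain c where c: "x = (\<Sum>v\<in>S. c v *\<^sub>R v)" "\<And>v. v \<in> S \<Longrightarrow> 0 \<le> c v" using assms by (metis posE)
  have s: "0 \<le> sum c S" using c(2) by (rule sum_nonneg)
  show ?thesis
  \<comment> \<open>Adding 1 keeps the denominator positive when all coefficients vanish.\<close>
  proof (rule that[of "1 / (sum c S + 1)"])
    fix e :: real assume e: "0 \<le> e" "e \<le> 1 / (sum c S + 1)"
    have "e * sum c S \<le> e * (sum c S + 1)" using e by (intro mult_left_mono) auto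
    also have "\<dots> \<le> 1" using e s by (simp add: field_simps)
    finally have "(\<Sum>v\<in>S. e * c v) \<le> 1" by (simp add: sum_distrib_left)
    moreover have "e *\<^sub>R x = (\<Sum>v\<in>S. (e * c v) *\<^sub>R v)" by (simp add: c(1) scaleR_sum_right)
    moreover have "\<forall>v\<in>S. 0 \<le> e * c v" using e c by simp
    ultimately show "e *\<^sub>R x \<in> convex hull insert 0 S"
      unfolding hull_insert_0[OF assms(1,2)] mem_Collect_eq by (intro exI[of _ "\<lambda>v. e * c v"] conjI)
  qed (use s in auto)
qed

text \<open>A point of two cones is shrunk towards the apex until it lies in both simplices; there
  the intersection property of the complex applies, and scaling back returns to the cone.\<close>

lemma star_simp_fan:
  fixes D :: "(real^'n::finite) set set"
  assumes D: "geom_complex TYPE('n) D"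
  shows "simp_fan ((\<lambda>\<sigma>. (+) (- p) ` (\<sigma> - {p})) ` {\<sigma>\<in>D. p \<in> \<sigma>})"
  unfolding simp_fan_def
proof (intro conjI ballI subsetI)
  let ?t = "(+) (- p)"
  have ins: "insert 0 (?t ` (\<sigma> - {p})) = ?t ` \<sigma>" if "p \<in> \<sigma>" for \<sigma>
    using that by force
  fix S assume "S \<in> (\<lambda>\<sigma>. ?t ` (\<sigma> - {p})) ` {\<sigma>\<in>D. p \<in> \<sigma>}"
  then obtain \<sigma> where \<sigma>: "\<sigma> \<in> D" "p \<in> \<sigma>" and S: "S = ?t ` (\<sigma> - {p})" by auto
  have g: "finite \<sigma>" "\<not> affine_dependent \<sigma>" using D \<sigma> by (auto simp: geom_complex_def)
  show finS: "finite S" using g S by simp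
  show "independent S"
    using affine_dependent_iff_dependent[of p "\<sigma> - {p}"] g \<sigma> by (simp add: S insert_absorb)
  fix T x assume "T \<in> (\<lambda>\<sigma>. ?t ` (\<sigma> - {p})) ` {\<sigma>\<in>D. p \<in> \<sigma>}" and x: "x \<in> pos S \<inter> pos T"
  then obtain \<tau> where \<tau>: "\<tau> \<in> D" "p \<in> \<tau>" and T: "T = ?t ` (\<tau> - {p})" by auto
  have "finite \<tau>" using D \<tau>(1) unfolding geom_complex_def by blast
  then have finT: "finite T" unfolding T by simp
  have 0: "0 \<notin> S" "0 \<notin> T" unfolding S T by auto
  obtain d where d: "0 < d" "\<And>e. 0 \<le> e \<Longrightarrow> e \<le> d \<Longrightarrow> e *\<^sub>R x \<in> convex hull insert 0 S"
    using pos_scaled_insert_0[OF finS 0(1)] x by blast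
  obtain d' where d': "0 < d'" "\<And>e. 0 \<le> e \<Longrightarrow> e \<le> d' \<Longrightarrow> e *\<^sub>R x \<in> convex hull insert 0 T"
    using pos_scaled_insert_0[OF finT 0(2)] x by blast
  define e where "e = min d d'"
  have e: "0 < e" "e *\<^sub>R x \<in> convex hull insert 0 S" "e *\<^sub>R x \<in> convex hull insert 0 T"
    using d(1) d'(1) d(2)[of e] d'(2)[of e] by (auto simp: e_def)
  have "convex hull \<sigma> \<inter> convex hull \<tau> = convex hull (\<sigma> \<inter> \<tau>)"
    using D \<sigma> \<tau> unfolding geom_complex_def by blast
  then have "e *\<^sub>R x \<in> ?t ` (convex hull (\<sigma> \<inter> \<tau>))"
    using e(2,3) unfolding S T ins[OF \<sigma>(2)] ins[OF \<tau>(2)] convex_hull_translation by auto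
  also have "\<dots> = convex hull (insert 0 (?t ` (\<sigma> \<inter> \<tau> - {p})))"
    unfolding convex_hull_translation[symmetric] using ins[of "\<sigma> \<inter> \<tau>"] \<sigma> \<tau> by simp
  also have "?t ` (\<sigma> \<inter> \<tau> - {p}) = S \<inter> T" by (auto simp: S T)
  finally have "e *\<^sub>R x \<in> pos (S \<inter> T)"
    using hull_insert_0_subset_pos[of "S \<inter> T"] finS 0 by auto
  from pos_scale[OF this, of "1 / e"] show "x \<in> pos (S \<inter> T)" using e by simp
qed

text \<open>Within one affinely independent set, hulls of subsets intersect in the hull of the
  intersection. This is applied in \<sigma> and in \<tau>, after confining the intersection to the
  hull of their common vertices, and then once more in \<sigma>.\<close>

lemma hull_Int_faces:
  fixes \<sigma> \<tau> :: "'a::euclidean_space set"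
  assumes "\<not> affine_dependent \<sigma>" "\<not> affine_dependent \<tau>" "\<sigma>' \<subseteq> \<sigma>" "\<tau>' \<subseteq> \<tau>"
    and "convex hull \<sigma> \<inter> convex hull \<tau> = convex hull (\<sigma> \<inter> \<tau>)"
  shows "convex hull \<sigma>' \<inter> convex hull \<tau>' = convex hull (\<sigma>' \<inter> \<tau>')"
proof
  have Int: "convex hull A \<inter> convex hull B = convex hull (A \<inter> B)"
    if "\<not> affine_dependent C" "A \<subseteq> C" "B \<subseteq> C" for A B C :: "'a set"
    using that by (intro convex_hull_Int[symmetric] affine_independent_subset[OF that(1)]) auto
  have "convex hull \<sigma>' \<inter> convex hull \<tau>' \<subseteq> convex hull (\<sigma> \<inter> \<tau>)"
    using hull_mono[OF assms(3)] hull_mono[OF assms(4)] assms(5) by blast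
  then have "convex hull \<sigma>' \<inter> convex hull \<tau>'
      \<subseteq> (convex hull \<sigma>' \<inter> convex hull (\<sigma> \<inter> \<tau>)) \<inter> (convex hull \<tau>' \<inter> convex hull (\<sigma> \<inter> \<tau>))" by blast
  also have "\<dots> = convex hull (\<sigma>' \<inter> (\<sigma> \<inter> \<tau>)) \<inter> convex hull (\<tau>' \<inter> (\<sigma> \<inter> \<tau>))"
    using Int[OF assms(1,3), of "\<sigma> \<inter> \<tau>"] Int[OF assms(2,4), of "\<sigma> \<inter> \<tau>"] by simp
  also have "\<dots> = convex hull (\<sigma>' \<inter> (\<sigma> \<inter> \<tau>) \<inter> (\<tau>' \<inter> (\<sigma> \<inter> \<tau>)))"
    using assms by (intro Int[of \<sigma>]) auto
  also have "\<sigma>' \<inter> (\<sigma> \<inter> \<tau>) \<inter> (\<tau>' \<inter> (\<sigma> \<inter> \<tau>)) = \<sigma>' \<inter> \<tau>'" using assms by blast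
  finally show "convex hull \<sigma>' \<inter> convex hull \<tau>' \<subseteq> convex hull (\<sigma>' \<inter> \<tau>')" .
qed (simp add: hull_mono)

lemma affine_independent_insert_0:
  assumes "simp_fan \<S>" "S \<in> \<S>" shows "\<not> affine_dependent (insert 0 S)"
  using affine_dependent_iff_dependent[of 0 S] simp_fanD[OF assms] by simp

lemma simp_fan_star_complex:
  fixes \<S> :: "(real^'n::finite) set set"
  assumes fan: "simp_fan \<S>" and fin: "finite \<S>"
  shows "geom_complex TYPE('n) {\<sigma>. \<sigma> \<noteq> {} \<and> (\<exists>S\<in>\<S>. \<sigma> \<subseteq> insert 0 S)}" (is "geom_complex _ ?D")
  unfolding geom_complex_def
proof (intro conjI ballI allI impI)
  fix \<sigma> assume "\<sigma> \<in> ?D"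
  then obtain S where S: "S \<in> \<S>" "\<sigma> \<subseteq> insert 0 S" "\<sigma> \<noteq> {}" by auto
  show "\<sigma> \<noteq> {}" "finite \<sigma>" using S simp_fanD(1)[OF fan S(1)] by (auto intro: finite_subset)
  show "\<not> affine_dependent \<sigma>"
    using affine_independent_subset[OF affine_independent_insert_0[OF fan S(1)] S(2)] .
  show "\<tau> \<in> ?D" if "\<tau> \<subseteq> \<sigma> \<and> \<tau> \<noteq> {}" for \<tau>
    using that S by (intro CollectI conjI bexI[of _ S]) auto
  fix \<tau> assume "\<tau> \<in> ?D"
  then obtain T where T: "T \<in> \<S>" "\<tau> \<subseteq> insert 0 T" by auto
  show "convex hull \<sigma> \<inter> convex hull \<tau> = convex hull (\<sigma> \<inter> \<tau>)"
    by (rule hull_Int_faces[OF affine_independent_insert_0[OF fan S(1)]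
          affine_independent_insert_0[OF fan T(1)] S(2) T(2)])
       (simp add: simp_fan_hull_insert_Int[OF fan S(1) T(1)])
next
  have "finite (\<Union>S\<in>\<S>. Pow (insert 0 S))" using fin simp_fanD(1)[OF fan] by auto
  then have "finite ?D" by (rule rev_finite_subset) auto
  then show "\<exists>e>0. finite {\<sigma>\<in>?D. convex hull \<sigma> \<inter> ball x e \<noteq> {}}" for x
    by (intro exI[of _ 1] conjI zero_less_one) (rule finite_subset[rotated], auto)
qed

lemma simp_fan_geom_complex:
  fixes \<S> :: "(real^'n::finite) set set"
  assumes fan: "simp_fan \<S>" and fin: "finite \<S>" and ne: "{} \<notin> \<S>"
    and sub: "\<And>S T. S \<in> \<S> \<Longrightarrow> T \<subseteq> S \<Longrightarrow> T \<noteq> {} \<Longrightarrow> T \<in> \<S>"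
  shows "geom_complex TYPE('n) \<S>"
  unfolding geom_complex_def
proof (intro conjI ballI allI impI)
  fix S assume S: "S \<in> \<S>"
  show "S \<noteq> {}" "finite S" "\<not> affine_dependent S"
    using S ne simp_fanD(1,2)[OF fan S] affine_dependent_imp_dependent by auto
  show "T \<in> \<S>" if "T \<subseteq> S \<and> T \<noteq> {}" for T using sub S that by blast
  fix T assume T: "T \<in> \<S>"
  show "convex hull S \<inter> convex hull T = convex hull (S \<inter> T)"
    by (rule simp_fan_hull_Int[OF fan S T])
next
  show "\<exists>e>0. finite {\<sigma>\<in>\<S>. convex hull \<sigma> \<inter> ball x e \<noteq> {}}" for x
    using fin by (intro exI[of _ 1]) auto
qed

text \<open>Applying a to a linear relation shows that its coefficients sum to 0, so the relation
  would be an affine one.\<close>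

lemma independent_hyperplane:
  fixes S :: "'a::real_inner set"
  assumes "finite S" "\<not> affine_dependent S" "\<And>x. x \<in> S \<Longrightarrow> a \<bullet> x = 1"
  shows "independent S"
proof
  assume "dependent S"
  then obtain c where c: "\<exists>v\<in>S. c v \<noteq> 0" "(\<Sum>v\<in>S. c v *\<^sub>R v) = 0"
    using assms(1) by (auto simp: real_vector.dependent_finite)
  have "0 = a \<bullet> (\<Sum>v\<in>S. c v *\<^sub>R v)" using c by simp
  also have "\<dots> = sum c S" using assms(3) by (simp add: inner_sum_right)
  finally show False using c assms(2) affine_dependent_explicit_finite[OF assms(1)] by metis
qed

text \<open>By \<open>hyp\<close> the point p is off a hyperplane through each simplex, which gives
  independence; by \<open>radial\<close> each ray from p meets the complex at most once. This serves
  both an interior point of a polytope and a point beside a flat complex.\<close>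

lemma translated_simp_fan:
  fixes L :: "(real^'n::finite) set set"
  assumes L: "geom_complex TYPE('n) L"
    and hyp: "\<And>S. S \<in> L \<Longrightarrow> \<exists>a. \<forall>x\<in>S. a \<bullet> (x - p) = 1"
    and radial: "\<And>x t. p + x \<in> carrier L \<Longrightarrow> 0 < t \<Longrightarrow> p + t *\<^sub>R x \<in> carrier L \<Longrightarrow> t = 1"
  shows "simp_fan ((`) ((+) (- p)) ` L)"
proof (rule simp_fan_radial)
  let ?t = "(+) (- p)"
  fix S' assume "S' \<in> (`) ?t ` L"
  then obtain S where S: "S \<in> L" "S' = ?t ` S" by auto
  obtain a where a: "\<forall>x\<in>S. a \<bullet> (x - p) = 1" using hyp[OF S(1)] by blast
  have "finite S" "\<not> affine_dependent S" using L S(1) by (auto simp: geom_complex_def)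
  then have "finite S'" "\<not> affine_dependent S'"
    using affine_dependent_translation_eq[of S "- p"] by (auto simp: S)
  moreover have "a \<bullet> x = 1" if "x \<in> S'" for x using that a by (auto simp: S)
  ultimately show "finite S' \<and> independent S'" using independent_hyperplane by blast
  fix T' assume "T' \<in> (`) ?t ` L"
  then obtain T where T: "T \<in> L" "T' = ?t ` T" by auto
  have "convex hull S \<inter> convex hull T = convex hull (S \<inter> T)"
    using L S(1) T(1) unfolding geom_complex_def by blast
  then show "convex hull S' \<inter> convex hull T' \<subseteq> convex hull (S' \<inter> T')"
    unfolding S T convex_hull_translation image_Int[OF inj_on_add, symmetric] by simp
  fix x t assume x: "x \<in> convex hull S'" "0 < t" "t *\<^sub>R x \<in> convex hull T'"
  have "p + x \<in> convex hull S" "p + t *\<^sub>R x \<in> convex hull T"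
    using x(1,3) unfolding S(2) T(2) convex_hull_translation by auto
  then show "t = 1" using radial[of x t] x(2) S(1) T(1) by (auto simp: carrier_def)
qed

subsection \<open>Boundary complexes of polytopes and Delaunay stars\<close>

text \<open>Here n counts the vertices of a facet, so the complex has dimension n - 1. The last
  clause puts every wall in at least two facets.\<close>

definition closed_pure :: "nat \<Rightarrow> 'v set set \<Rightarrow> bool" where
  "closed_pure n \<S> \<longleftrightarrow> finite \<S> \<and> \<S> \<noteq> {} \<and> (\<forall>S\<in>\<S>. S \<noteq> {} \<and> finite S) \<and>
     (\<forall>S\<in>\<S>. \<forall>T. T \<subseteq> S \<and> T \<noteq> {} \<longrightarrow> T \<in> \<S>) \<and>
     (\<forall>S\<in>\<S>. \<exists>F\<in>\<S>. S \<subseteq> F \<and> card F = n) \<and>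
     (\<forall>F\<in>\<S>. card F = n \<longrightarrow> (\<forall>v\<in>F. \<exists>w. w \<notin> F \<and> insert w (F - {v}) \<in> \<S>))"

lemma closed_pureD:
  assumes "closed_pure n \<S>"
  shows "finite \<S>" "\<S> \<noteq> {}" "S \<in> \<S> \<Longrightarrow> S \<noteq> {}" "S \<in> \<S> \<Longrightarrow> finite S"
    "S \<in> \<S> \<Longrightarrow> T \<subseteq> S \<Longrightarrow> T \<noteq> {} \<Longrightarrow> T \<in> \<S>"
    "S \<in> \<S> \<Longrightarrow> \<exists>F\<in>\<S>. S \<subseteq> F \<and> card F = n"
    "F \<in> \<S> \<Longrightarrow> card F = n \<Longrightarrow> v \<in> F \<Longrightarrow> \<exists>w. w \<notin> F \<and> insert w (F - {v}) \<in> \<S>"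
proof -
  note c = assms[unfolded closed_pure_def]
  show "finite \<S>" "\<S> \<noteq> {}" using c by simp_all
  show "S \<in> \<S> \<Longrightarrow> S \<noteq> {}" "S \<in> \<S> \<Longrightarrow> finite S" using c by simp_all
  show "S \<in> \<S> \<Longrightarrow> T \<subseteq> S \<Longrightarrow> T \<noteq> {} \<Longrightarrow> T \<in> \<S>"
    "S \<in> \<S> \<Longrightarrow> \<exists>F\<in>\<S>. S \<subseteq> F \<and> card F = n"
    "F \<in> \<S> \<Longrightarrow> card F = n \<Longrightarrow> v \<in> F \<Longrightarrow> \<exists>w. w \<notin> F \<and> insert w (F - {v}) \<in> \<S>"
    using c by metis+
qed

lemma closed_pure_card_le: "closed_pure n \<S> \<Longrightarrow> S \<in> \<S> \<Longrightarrow> card S \<le> n"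
  by (metis card_mono closed_pureD(4,6))

lemma closed_pure_image:
  assumes cp: "closed_pure n \<S>" and inj: "inj_on f (\<Union>\<S>)"
  shows "closed_pure n ((`) f ` \<S>)"
proof -
  have cf: "card (f ` S) = card S" if "S \<in> \<S>" for S
    using inj that by (intro card_image inj_on_subset[OF inj]) auto
  show ?thesis
    unfolding closed_pure_def
  proof (intro conjI ballI allI impI)
    show "finite ((`) f ` \<S>)" "(`) f ` \<S> \<noteq> {}" using closed_pureD(1,2)[OF cp] by auto
    fix S' assume "S' \<in> (`) f ` \<S>"
    then obtain S where S: "S \<in> \<S>" "S' = f ` S" by auto
    show "S' \<noteq> {}" "finite S'" using closed_pureD(3,4)[OF cp S(1)] S by auto
    show "T' \<in> (`) f ` \<S>" if T': "T' \<subseteq> S' \<and> T' \<noteq> {}" for T'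
    proof -
      obtain T where "T \<subseteq> S" "T' = f ` T" using T' S by (meson subset_imageE)
      then show ?thesis using closed_pureD(5)[OF cp S(1)] T' by blast
    qed
    show "\<exists>F\<in>(`) f ` \<S>. S' \<subseteq> F \<and> card F = n"
    proof -
      obtain F where "F \<in> \<S>" "S \<subseteq> F" "card F = n" using closed_pureD(6)[OF cp S(1)] by blast
      then show ?thesis using cf S by (intro bexI[of _ "f ` F"]) auto
    qed
    fix v' assume "card S' = n" and v': "v' \<in> S'"
    then have n: "card S = n" using cf S by simp
    obtain v where v: "v \<in> S" "v' = f v" using v' S by auto
    obtain w where w: "w \<notin> S" "insert w (S - {v}) \<in> \<S>" using closed_pureD(7)[OF cp S(1) n v(1)] by blast
    have "f w \<notin> f ` S"
      using w S(1) inj by (auto simp: inj_on_def)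
    moreover have "insert (f w) (f ` S - {f v}) = f ` insert w (S - {v})"
      using v S(1) inj by (auto simp: inj_on_def)
    then have "insert (f w) (f ` S - {f v}) \<in> (`) f ` \<S>" using w(2) by (metis imageI)
    ultimately show "\<exists>w. w \<notin> S' \<and> insert w (S' - {v'}) \<in> (`) f ` \<S>"
      unfolding S(2) v(2) by blast
  qed
qed

lemma closed_fan_facets:
  fixes \<S> :: "'a::euclidean_space set set"
  assumes fan: "simp_fan \<S>" and cp: "closed_pure DIM('a) \<S>"
  shows "closed_fan {F\<in>\<S>. card F = DIM('a)}"
  unfolding closed_fan_def
proof (intro conjI ballI)
  show "simp_fan {F\<in>\<S>. card F = DIM('a)}" using fan by (simp add: simp_fan_def)
  show "finite {F\<in>\<S>. card F = DIM('a)}" using closed_pureD(1)[OF cp] by simp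
  show "{F\<in>\<S>. card F = DIM('a)} \<noteq> {}" using closed_pureD(2,6)[OF cp] by blast
  fix F assume "F \<in> {F\<in>\<S>. card F = DIM('a)}"
  then have F: "F \<in> \<S>" "card F = DIM('a)" by auto
  show "card F = DIM('a)" by fact
  fix v assume v: "v \<in> F"
  obtain w where w: "w \<notin> F" "insert w (F - {v}) \<in> \<S>" using closed_pureD(7)[OF cp F v] by blast
  have "card (insert w (F - {v})) = Suc (card (F - {v}))"
    using w closed_pureD(4)[OF cp F(1)] by (intro card_insert_disjoint) auto
  also have "\<dots> = card F" using v closed_pureD(4)[OF cp F(1)] by (intro card_Suc_Diff1)
  finally have "card (insert w (F - {v})) = card F" .
  then show "\<exists>w. w \<notin> F \<and> insert w (F - {v}) \<in> {F\<in>\<S>. card F = DIM('a)}" using w F by auto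
qed

text \<open>The coefficients of q over S are 1 at q and 0 elsewhere. Their sum survives restriction
  to the vertices shared with T, so q is one of these.\<close>

lemma simp_fan_vertex_in_pos:
  assumes "simp_fan \<S>" "S \<in> \<S>" "T \<in> \<S>" "q \<in> S" "q \<in> pos T"
  shows "q \<in> T"
proof (rule ccontr)
  assume q: "q \<notin> T"
  note S = simp_fanD[OF assms(1,2)]
  let ?c = "\<lambda>v. if v = q then 1 else 0::real"
  have "q = (\<Sum>v\<in>S. ?c v *\<^sub>R v)"
    using assms(4) S(1) by (simp add: if_distrib[of "\<lambda>c. c *\<^sub>R _"] cong: if_cong)
  from simp_fan_expansion(2)[OF assms(1-3) this _ assms(5)] have "sum ?c (S \<inter> T) = sum ?c S" by simp
  then show False using q assms(4) S(1) by simp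
qed

text \<open>By \<open>closed_fan_support\<close> the hull is the intersection of the half spaces
  where \<open>a F\<close> is at most 1, and its frontier is where the largest \<open>a F\<close>
  equals 1. On the cone of F this functional is the coefficient sum, so a frontier point lies in the
  hull of its maximising facet.\<close>

lemma convex_fan_polytope:
  fixes \<S> :: "(real^'n::finite) set set"
  assumes fan: "simp_fan \<S>" and cp: "closed_pure CARD('n) \<S>"
    and a: "\<And>F u. F \<in> \<S> \<Longrightarrow> card F = CARD('n) \<Longrightarrow> u \<in> F \<Longrightarrow> a F \<bullet> u = 1"
    and loc: "\<And>F v w. F \<in> \<S> \<Longrightarrow> card F = CARD('n) \<Longrightarrow> v \<in> F \<Longrightarrow> w \<notin> F \<Longrightarrow>
      insert w (F - {v}) \<in> \<S> \<Longrightarrow> a F \<bullet> w \<le> 1"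
  shows "carrier \<S> = frontier (convex hull insert 0 (\<Union>\<S>))"
proof -
  define \<F> where "\<F> = {F\<in>\<S>. card F = CARD('n)}"
  define P where "P = convex hull insert 0 (\<Union>\<S>)"
  have cf: "closed_fan \<F>" using closed_fan_facets[OF fan] cp by (simp add: \<F>_def)
  have \<F>: "F \<in> \<S>" "card F = CARD('n)" "finite F" "0 \<notin> F" if "F \<in> \<F>" for F
    using that simp_fanD(1,3)[OF fan] by (auto simp: \<F>_def)
  have fin\<F>: "finite \<F>" using cf by (simp add: closed_fan_def)
  have sup: "\<exists>F\<in>\<F>. y \<in> pos F \<and> (\<forall>G\<in>\<F>. a G \<bullet> y \<le> a F \<bullet> y)" for y
    by (rule closed_fan_support[OF cf]) (use a loc in \<open>auto simp: \<F>_def\<close>)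
  \<comment> \<open>From neighbours to all vertices: a maximising facet whose cone contains q has q
    as a vertex, so the maximum at q is 1.\<close>
  have aq: "a G \<bullet> q \<le> 1" if q: "q \<in> \<Union>\<S>" and G: "G \<in> \<F>" for q G
  proof -
    obtain F where F: "F \<in> \<F>" "q \<in> pos F" "a G \<bullet> q \<le> a F \<bullet> q" using sup[of q] G by blast
    obtain S where S: "S \<in> \<S>" "q \<in> S" using q by blast
    have "q \<in> F" using simp_fan_vertex_in_pos[OF fan S(1) \<F>(1)[OF F(1)] S(2) F(2)] .
    then show ?thesis using F(3) a[OF \<F>(1,2)[OF F(1)]] by simp
  qed
  have P_le: "a G \<bullet> x \<le> 1" if "G \<in> \<F>" "x \<in> P" for G x
  proof -
    have "P \<subseteq> {x. a G \<bullet> x \<le> 1}"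
      unfolding P_def by (rule hull_minimal) (use aq that in \<open>auto intro: convex_halfspace_le\<close>)
    then show ?thesis using that by blast
  qed
  have aval: "a F \<bullet> (\<Sum>v\<in>F. c v *\<^sub>R v) = sum c F" if "F \<in> \<F>" for F c
    using a[OF \<F>(1,2)[OF that]] by (simp add: inner_sum_right)
  have P_ge: "x \<in> P" if "\<forall>G\<in>\<F>. a G \<bullet> x \<le> 1" for x
  proof -
    obtain F where F: "F \<in> \<F>" "x \<in> pos F" using sup[of x] by blast
    obtain c where c: "x = (\<Sum>v\<in>F. c v *\<^sub>R v)" "\<And>v. v \<in> F \<Longrightarrow> 0 \<le> c v" using F(2) by (metis posE)
    have "sum c F \<le> 1" using aval[OF F(1), of c] that F(1) c(1) by auto
    then have "x \<in> convex hull insert 0 F"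
      unfolding hull_insert_0[OF \<F>(3,4)[OF F(1)]] using c by blast
    moreover have "insert 0 F \<subseteq> insert 0 (\<Union>\<S>)" using \<F>(1)[OF F(1)] by blast
    ultimately show ?thesis unfolding P_def using hull_mono by blast
  qed
  have "finite (\<Union>\<S>)" using closed_pureD(1,4)[OF cp] by blast
  then have "closed P"
    unfolding P_def by (intro compact_imp_closed finite_imp_compact_convex_hull) simp
  then have fr: "frontier P = P - interior P" by (simp add: frontier_def)
  have int: "x \<in> interior P \<longleftrightarrow> (\<forall>G\<in>\<F>. a G \<bullet> x < 1)" for x
  proof
    assume x: "x \<in> interior P"
    show "\<forall>G\<in>\<F>. a G \<bullet> x < 1"
    proof
      fix G assume G: "G \<in> \<F>"
      have "G \<noteq> {}" using closed_pureD(3)[OF cp] \<F>(1)[OF G] by blast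
      then have "a G \<noteq> 0" using a[OF \<F>(1,2)[OF G]] by fastforce
      moreover have "interior P \<subseteq> interior {x. a G \<bullet> x \<le> 1}"
        using P_le[OF G] by (intro interior_mono) auto
      ultimately show "a G \<bullet> x < 1" using x by auto
    qed
  next
    assume x: "\<forall>G\<in>\<F>. a G \<bullet> x < 1"
    have "open (\<Inter>G\<in>\<F>. {x. a G \<bullet> x < 1})" using fin\<F> by (intro open_INT) (auto intro: open_halfspace_lt)
    moreover have "(\<Inter>G\<in>\<F>. {x. a G \<bullet> x < 1}) \<subseteq> P" using P_ge by (auto intro: less_imp_le)
    ultimately show "x \<in> interior P" using x by (intro interiorI) auto
  qed
  have "carrier \<S> = frontier P"
  proof (intro set_eqI iffI)
    fix x assume "x \<in> carrier \<S>"
    then obtain S where S: "S \<in> \<S>" "x \<in> convex hull S" by (auto simp: carrier_def)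
    obtain F where "F \<in> \<S>" "S \<subseteq> F" "card F = CARD('n)" using closed_pureD(6)[OF cp S(1)] by blast
    then have F: "F \<in> \<F>" "x \<in> convex hull F" using S hull_mono[of S F] by (auto simp: \<F>_def)
    then obtain c where c: "sum c F = 1" "x = (\<Sum>v\<in>F. c v *\<^sub>R v)"
      by (auto simp: convex_hull_finite[OF \<F>(3)])
    have "a F \<bullet> x = 1" unfolding c(2) aval[OF F(1)] c(1) ..
    then have "x \<notin> interior P" using int F(1) by force
    moreover have "convex hull F \<subseteq> P" unfolding P_def using \<F>(1)[OF F(1)] by (intro hull_mono) auto
    ultimately show "x \<in> frontier P" unfolding fr using F(2) by blast
  next
    fix x assume x: "x \<in> frontier P"
    obtain F where F: "F \<in> \<F>" "x \<in> pos F" "\<forall>G\<in>\<F>. a G \<bullet> x \<le> a F \<bullet> x" using sup[of x] by blast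
    obtain c where c: "x = (\<Sum>v\<in>F. c v *\<^sub>R v)" "\<And>v. v \<in> F \<Longrightarrow> 0 \<le> c v" using F(2) by (metis posE)
    obtain G where "G \<in> \<F>" "\<not> a G \<bullet> x < 1" using x int[of x] by (auto simp: fr)
    then have "1 \<le> a F \<bullet> x" using F(3) by force
    moreover have "a F \<bullet> x \<le> 1" using P_le[OF F(1)] x by (simp add: fr)
    ultimately have "sum c F = 1" using aval[OF F(1), of c] c(1) by simp
    then have "x \<in> convex hull F" unfolding convex_hull_finite[OF \<F>(3)[OF F(1)]] using c by blast
    then show "x \<in> carrier \<S>" using \<F>(1)[OF F(1)] by (auto simp: carrier_def)
  qed
  then show ?thesis by (simp add: P_def)
qed

text \<open>Near 0 all coefficient sums are below 1, so a point lies not only in some cone but in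
  the corresponding simplex with apex 0.\<close>

lemma closed_fan_star_interior:
  fixes \<F> :: "'a::euclidean_space set set"
  assumes cf: "closed_fan \<F>"
  shows "0 \<in> interior (\<Union>F\<in>\<F>. convex hull insert 0 F)"
proof (rule interiorI)
  let ?U = "\<Inter>F\<in>\<F>. {x. (\<Sum>v\<in>F. coord F x v) < 1}"
  note b = closed_fan_basis[OF cf]
  show "open ?U"
    using cf b by (intro open_INT ballI open_Collect_less continuous_on_sum continuous_coord)
      (auto simp: closed_fan_def)
  show "0 \<in> ?U" by (auto simp: coord_linear(4)[OF b])
  show "?U \<subseteq> (\<Union>F\<in>\<F>. convex hull insert 0 F)"
  proof
    fix x assume x: "x \<in> ?U"
    obtain F where F: "F \<in> \<F>" "x \<in> pos F" using closed_fan_complete[OF cf] by blast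
    have "simp_fan \<F>" using cf by (simp add: closed_fan_def)
    note f = simp_fanD(1,3)[OF this F(1)]
    have "x = (\<Sum>v\<in>F. coord F x v *\<^sub>R v)" by (simp add: coord_sum[OF b[OF F(1)]])
    moreover have "\<forall>v\<in>F. 0 \<le> coord F x v" using F(2) by (simp add: pos_iff_coord[OF b[OF F(1)]])
    moreover have "(\<Sum>v\<in>F. coord F x v) \<le> 1" using x F(1) by (auto intro: less_imp_le)
    ultimately have "x \<in> convex hull insert 0 F" unfolding hull_insert_0[OF f] by blast
    then show "x \<in> (\<Union>F\<in>\<F>. convex hull insert 0 F)" using F(1) by blast
  qed
qed

text \<open>The centre 0 is a vertex of every top simplex, so each circumsphere passes through it
  and inverts to the plane of a facet; a vertex inside the ball would lie strictly beyond that
  supporting plane.\<close>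

lemma convex_fan_delaunay_star:
  fixes \<S> :: "(real^'n::finite) set set"
  assumes fan: "simp_fan \<S>" and cp: "closed_pure CARD('n) \<S>"
    and supp: "\<And>F. F \<in> \<S> \<Longrightarrow> card F = CARD('n) \<Longrightarrow>
      \<exists>a. (\<forall>u\<in>F. a \<bullet> u = 1) \<and> (\<forall>q\<in>\<Union>\<S>. a \<bullet> q \<le> 1)"
  defines "D \<equiv> {\<sigma>. \<sigma> \<noteq> {} \<and> (\<exists>S\<in>\<S>. \<sigma> \<subseteq> insert 0 (inversion 1 ` S))}"
  shows "discrete_domain TYPE('n) D" "locally_delaunay TYPE('n) D"
proof -
  let ?J = "inversion 1 :: real^'n \<Rightarrow> _"
  define \<T> where "\<T> = (`) ?J ` \<S>"
  have fanT: "simp_fan \<T>" unfolding \<T>_def by (rule simp_fan_inversion[OF _ fan]) simp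
  have cpT: "closed_pure CARD('n) \<T>" unfolding \<T>_def by (rule closed_pure_image[OF cp inj_inversion]) simp
  have D: "D = {\<sigma>. \<sigma> \<noteq> {} \<and> (\<exists>T\<in>\<T>. \<sigma> \<subseteq> insert 0 T)}" by (auto simp: D_def \<T>_def)
  have card1: "card (insert 0 T) = card T + 1" if "T \<in> \<T>" for T
    using simp_fanD(1,3)[OF fanT that] by simp
  have geom: "geom_complex TYPE('n) D"
    unfolding D by (rule simp_fan_star_complex[OF fanT closed_pureD(1)[OF cpT]])
  have pure: "pure_dim CARD('n) D"
    unfolding pure_dim_def
  proof (intro conjI ballI)
    fix \<sigma> assume "\<sigma> \<in> D"
    then obtain S where S: "S \<in> \<T>" "\<sigma> \<subseteq> insert 0 S" by (auto simp: D)
    obtain F where F: "F \<in> \<T>" "S \<subseteq> F" "card F = CARD('n)" using closed_pureD(6)[OF cpT S(1)] by blast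
    have sub: "\<sigma> \<subseteq> insert 0 F" using S F by blast
    have c: "card (insert 0 F) = CARD('n) + 1" using card1[OF F(1)] F(3) by simp
    show "\<exists>\<tau>\<in>D. \<sigma> \<subseteq> \<tau> \<and> card \<tau> = CARD('n) + 1"
      using F(1) c sub by (intro bexI[of _ "insert 0 F"]) (auto simp: D)
    show "card \<sigma> \<le> CARD('n) + 1"
      unfolding c[symmetric] using simp_fanD(1)[OF fanT F(1)] sub by (intro card_mono) auto
  qed
  \<comment> \<open>With \<open>CARD('n) + 1\<close> vertices a simplex must use the centre and an
    entire facet.\<close>
  have maxD: "\<exists>F\<in>\<S>. card F = CARD('n) \<and> \<sigma> = insert 0 (?J ` F)" if \<sigma>: "\<sigma> \<in> D" "card \<sigma> = CARD('n) + 1" for \<sigma>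
  proof -
    obtain S where S: "S \<in> \<S>" "\<sigma> \<subseteq> insert 0 (?J ` S)" using \<sigma>(1) unfolding D_def by blast
    have T: "?J ` S \<in> \<T>" using S by (simp add: \<T>_def)
    have fin: "finite (insert 0 (?J ` S))" using simp_fanD(1)[OF fanT T] by simp
    have "card (?J ` S) \<le> CARD('n)" by (rule closed_pure_card_le[OF cpT T])
    then have "\<sigma> = insert 0 (?J ` S)" "card (?J ` S) = CARD('n)"
      using card_mono[OF fin S(2)] card_subset_eq[OF fin S(2)] card1[OF T] \<sigma>(2) by auto
    moreover have "card (?J ` S) = card S" by (intro card_image inj_inversion) simp
    ultimately show ?thesis using S(1) by auto
  qed
  have insD: "insert 0 T \<in> D" if "T \<in> \<T>" for T unfolding D using that by blast
  have "closed_fan {F\<in>\<T>. card F = CARD('n)}"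
    using closed_fan_facets[OF fanT] cpT by simp
  then have "0 \<in> interior (\<Union>F\<in>{F\<in>\<T>. card F = CARD('n)}. convex hull insert 0 F)"
    by (rule closed_fan_star_interior)
  moreover have "(\<Union>F\<in>{F\<in>\<T>. card F = CARD('n)}. convex hull insert 0 F) \<subseteq> carrier D"
    unfolding carrier_def using insD by blast
  ultimately have int0: "0 \<in> interior (carrier D)" using interior_mono by blast
  let ?IV = "\<Union>D \<inter> interior (carrier D)"
  let ?R = "\<lambda>a b. a \<in> ?IV \<and> b \<in> ?IV \<and> {a, b} \<in> D"
  have "0 \<in> \<Union>D" using closed_pureD(2)[OF cpT] insD by blast
  then have IV0: "0 \<in> ?IV" using int0 by blast
  have edge: "{p, 0} \<in> D" if "p \<in> ?IV" for p
  proof -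
    obtain T where "T \<in> \<T>" "p \<in> insert 0 T" using \<open>p \<in> ?IV\<close> unfolding D by blast
    then show ?thesis unfolding D by blast
  qed
  \<comment> \<open>Paths of length two through the centre suffice.\<close>
  have conn: "?R\<^sup>*\<^sup>* p q" if p: "p \<in> ?IV" and q: "q \<in> ?IV" for p q
  proof (rule rtranclp.rtrancl_into_rtrancl[OF r_into_rtranclp])
    show "?R p 0" using p IV0 edge[OF p] by blast
    show "?R 0 q" using q IV0 edge[OF q] by (simp add: insert_commute)
  qed
  have "\<exists>p\<in>\<sigma>. p \<in> interior (carrier D)" if "\<sigma> \<in> D" "card \<sigma> = CARD('n) + 1" for \<sigma>
    using maxD[OF that] int0 by blast
  then show "discrete_domain TYPE('n) D"
    unfolding discrete_domain_def Let_def using geom pure conn by blast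
  show "locally_delaunay TYPE('n) D"
    unfolding locally_delaunay_def
  proof (intro ballI impI allI notI)
    fix \<sigma> \<sigma>' c r q
    assume \<sigma>: "\<sigma> \<in> D" "\<sigma>' \<in> D" "card \<sigma> = CARD('n) + 1 \<and> card \<sigma>' = CARD('n) + 1 \<and> card (\<sigma> \<inter> \<sigma>') = CARD('n)"
      and c: "\<forall>p\<in>\<sigma>. dist c p = r" and q: "q \<in> \<sigma>'" "dist c q < r"
    obtain F where F: "F \<in> \<S>" "card F = CARD('n)" "\<sigma> = insert 0 (?J ` F)" using maxD \<sigma> by blast
    obtain G where G: "G \<in> \<S>" "\<sigma>' = insert 0 (?J ` G)" using maxD \<sigma> by blast
    have r: "r = norm c" using c F(3) by (auto simp: dist_norm)
    then have "q \<noteq> 0" using q by auto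
    then obtain s where s: "s \<in> G" "q = ?J s" using q G by auto
    have sS: "s \<in> \<Union>\<S>" using s G by blast
    have bF: "is_basis F" using simp_fanD(2)[OF fan F(1)] F(2) by (simp add: is_basis_def)
    obtain a where a: "\<forall>u\<in>F. a \<bullet> u = 1" "\<forall>q\<in>\<Union>\<S>. a \<bullet> q \<le> 1" using supp[OF F(1,2)] by blast
    have u: "(2 *\<^sub>R c) \<bullet> u = 1" if "u \<in> F" for u
    proof -
      have "u \<noteq> 0" using that simp_fanD(3)[OF fan F(1)] by auto
      then have "?J u \<noteq> 0" "dist c (?J u) = norm c" using c F(3) r that by auto
      then show ?thesis using sphere_inversion(2)[of 1 "?J u" c] by simp
    qed
    \<comment> \<open>A functional with value 1 on the basis F is determined by this, so the
      inverted circumsphere \<open>2 *\<^sub>R c\<close> and the supporting plane a agree at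
      s.\<close>
    have ex: "b \<bullet> s = (\<Sum>u\<in>F. coord F s u)" if "\<And>u. u \<in> F \<Longrightarrow> b \<bullet> u = 1" for b
    proof -
      have "b \<bullet> s = b \<bullet> (\<Sum>u\<in>F. coord F s u *\<^sub>R u)" by (simp add: coord_sum[OF bF])
      also have "\<dots> = (\<Sum>u\<in>F. coord F s u)" using that by (simp add: inner_sum_right)
      finally show ?thesis .
    qed
    have "(2 *\<^sub>R c) \<bullet> s = a \<bullet> s" using ex[OF u] ex[of a] a(1) by simp
    moreover have "1 < (2 *\<^sub>R c) \<bullet> s"
      using sphere_inversion(1)[of 1 q c] \<open>q \<noteq> 0\<close> q(2) r s(2) by simp
    ultimately show False using a(2) sS by fastforce
  qed
qed

section \<open>Rays and supporting planes of a convex body\<close>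

text \<open>On a segment from an interior point to a point of the closure all points before the end
  are interior, so a ray meets the frontier only once.\<close>

lemma frontier_radial:
  fixes P :: "'a::euclidean_space set"
  assumes P: "convex P" and p: "p \<in> interior P"
    and x: "p + x \<in> frontier P" "0 < t" "p + t *\<^sub>R x \<in> frontier P"
  shows "t = 1"
proof -
  have less: False if "p + y \<in> frontier P" "0 < s" "s < 1" "p + s *\<^sub>R y \<in> frontier P" for y s
  proof -
    have "(p + y) - s *\<^sub>R ((p + y) - p) \<in> interior P" if "0 < s" "s \<le> 1" for s :: real
      using mem_interior_closure_convex_shrink[OF P p _ that, of "p + y"] \<open>p + y \<in> frontier P\<close>
      by (simp add: frontier_def)
    from this[of "1 - s"] have "p + s *\<^sub>R y \<in> interior P"
      using that by (simp add: algebra_simps)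
    then show False using that by (simp add: frontier_def)
  qed
  have "\<not> t < 1" using less[OF x(1,2) _ x(3)] by blast
  moreover have "\<not> 1 < t"
    using less[OF x(3), of "1 / t"] x by (auto simp: divide_simps)
  ultimately show ?thesis by simp
qed

text \<open>P is supported at the barycentre of S. The normalised functional is at most 1 at each
  vertex of S and has average 1 over them, so it is 1 at every vertex.\<close>

lemma frontier_support:
  fixes P :: "'a::euclidean_space set"
  assumes P: "convex P" "closed P" and p: "p \<in> interior P"
    and S: "finite S" "S \<noteq> {}" "convex hull S \<subseteq> frontier P"
  obtains a where "\<And>x. x \<in> S \<Longrightarrow> a \<bullet> (x - p) = 1" "\<And>y. y \<in> P \<Longrightarrow> a \<bullet> (y - p) \<le> 1"
proof -
  define k where "k = 1 / real (card S)"
  have k: "0 < k" "real (card S) * k = 1" using S by (auto simp: k_def)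
  define z where "z = (\<Sum>x\<in>S. k *\<^sub>R x)"
  have "z \<in> convex hull S"
    unfolding z_def convex_hull_finite[OF S(1)] using k by (auto intro!: exI[of _ "\<lambda>_. k"])
  then have z: "z \<in> P" "z \<notin> interior P" using S(3) P(2) by (auto simp: frontier_def)
  have ri: "rel_interior P = interior P" using p by (intro rel_interior_nonempty_interior) auto
  obtain g where g: "\<And>y. y \<in> P \<Longrightarrow> g \<bullet> z \<le> g \<bullet> y" "\<And>y. y \<in> interior P \<Longrightarrow> g \<bullet> z < g \<bullet> y"
    using supporting_hyperplane_rel_boundary[OF P(1) z(1)] z(2) unfolding ri by metis
  \<comment> \<open>\<open>g\<close> is least at z, so its value at the interior point p is larger.
    Dividing by this gap and changing the sign puts the plane at level 1 as seen from p.\<close>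
  define m where "m = g \<bullet> p - g \<bullet> z"
  have m: "0 < m" using g(2)[OF p] by (simp add: m_def)
  define a where "a = (- 1 / m) *\<^sub>R g"
  have le: "a \<bullet> (y - p) \<le> 1" if "y \<in> P" for y
    using g(1)[OF that] m by (simp add: a_def inner_diff_right m_def divide_simps)
  have SP: "x \<in> P" if "x \<in> S" for x
    using S(3) hull_inc[OF that, of convex] P(2) by (auto simp: frontier_def)
  have "a \<bullet> (z - p) = 1" using m by (simp add: a_def inner_diff_right m_def divide_simps)
  moreover have "a \<bullet> (z - p) = (\<Sum>x\<in>S. k * (a \<bullet> (x - p)))"
    using k by (simp add: z_def inner_diff_right inner_sum_right right_diff_distrib sum_subtractf
        flip: mult.assoc)
  ultimately have "(\<Sum>x\<in>S. k * (1 - a \<bullet> (x - p))) = 0"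
    using k by (simp add: right_diff_distrib sum_subtractf)
  moreover have "0 \<le> k * (1 - a \<bullet> (x - p))" if "x \<in> S" for x using le[OF SP[OF that]] k by simp
  ultimately have "\<forall>x\<in>S. k * (1 - a \<bullet> (x - p)) = 0" using S(1) by (simp add: sum_nonneg_eq_0_iff)
  then have "a \<bullet> (x - p) = 1" if "x \<in> S" for x using that k by auto
  then show ?thesis using that le by blast
qed

lemma closed_pure_translation:
  fixes p :: "'a::ab_group_add"
  shows "closed_pure n L \<Longrightarrow> closed_pure n ((`) ((+) p) ` L)"
  by (rule closed_pure_image) (simp_all add: inj_on_def)

text \<open>A complex without boundary facets cannot be flat: the cones over a flat complex lie in a half
  space, whereas the cones of a closed fan cover everything.\<close>

lemma interior_nonempty_of_frontier_complex:
  fixes L :: "(real^'n::finite) set set"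
  assumes L: "geom_complex TYPE('n) L" and cp: "closed_pure CARD('n) L"
    and P: "convex P" "closed P" and fr: "carrier L = frontier P"
  shows "interior P \<noteq> {}"
proof
  assume "interior P = {}"
  then obtain a b where ab: "a \<noteq> 0" "P \<subseteq> {x. a \<bullet> x = b}"
    using empty_interior_subset_hyperplane[OF P(1)] by metis
  have car: "carrier L \<subseteq> {x. a \<bullet> x = b}" using ab(2) P(2) fr by (auto simp: frontier_def)
  \<comment> \<open>Chosen so that the hyperplane containing P lies at level 1 as seen from
    p.\<close>
  define p where "p = ((b - 1) / (a \<bullet> a)) *\<^sub>R a"
  have ap: "a \<bullet> p = b - 1" using ab(1) by (simp add: p_def)
  have one: "a \<bullet> (x - p) = 1" if "x \<in> carrier L" for x
    using that car ap by (auto simp: inner_diff_right)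
  have vert: "x \<in> carrier L" if "S \<in> L" "x \<in> S" for S x
    using that hull_inc[of x S convex] by (auto simp: carrier_def)
  have fan: "simp_fan ((`) ((+) (- p)) ` L)"
  proof (rule translated_simp_fan[OF L])
    show "\<exists>a. \<forall>x\<in>S. a \<bullet> (x - p) = 1" if "S \<in> L" for S
      using one vert[OF that] by blast
    show "t = 1" if "p + x \<in> carrier L" "0 < t" "p + t *\<^sub>R x \<in> carrier L" for x t
      using one[OF that(1)] one[OF that(3)] by simp
  qed
  have "closed_fan {F\<in>(`) ((+) (- p)) ` L. card F = DIM(real^'n)}"
    using closed_fan_facets[OF fan] closed_pure_translation[OF cp, of "- p"] by simp
  \<comment> \<open>All generators of the cones have inner product 1 with a, so no cone can contain
    \<open>- a\<close>.\<close>
  from closed_fan_complete[OF this, of "- a"]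
  obtain S where S: "S \<in> L" "- a \<in> pos ((+) (- p) ` S)" by blast
  from S(2) obtain c where c: "- a = (\<Sum>v\<in>(+) (- p) ` S. c v *\<^sub>R v)"
      "\<And>v. v \<in> (+) (- p) ` S \<Longrightarrow> 0 \<le> c v"
    by (rule posE) blast
  have "a \<bullet> (- a) = (\<Sum>v\<in>(+) (- p) ` S. c v * (a \<bullet> v))" 
    by (simp only: c(1) inner_sum_right inner_scaleR_right)
  also have "0 \<le> \<dots>"
  proof (intro sum_nonneg mult_nonneg_nonneg c(2))
    show "0 \<le> a \<bullet> v" if "v \<in> (+) (- p) ` S" for v using that one vert[OF S(1)] by auto
  qed
  finally show False using ab(1) by (simp add: inner_gt_zero_iff[symmetric] del: inner_gt_zero_iff)
qed

subsection \<open>Links of interior vertices\<close>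

lemma abs_complex_face: "abs_complex K \<Longrightarrow> \<sigma> \<in> K \<Longrightarrow> \<tau> \<subseteq> \<sigma> \<Longrightarrow> \<tau> \<noteq> {} \<Longrightarrow> \<tau> \<in> K"
  unfolding abs_complex_def by blast

lemma vertex_star_iff:
  assumes "abs_complex K"
  shows "T \<in> vertex_star K v \<longleftrightarrow> T \<noteq> {} \<and> insert v T \<in> K"
proof
  assume "T \<in> vertex_star K v"
  then obtain \<sigma> where "T \<in> K" "\<sigma> \<in> K" "insert v T \<subseteq> \<sigma>" by (auto simp: vertex_star_def)
  then show "T \<noteq> {} \<and> insert v T \<in> K" using assms unfolding abs_complex_def by blast
next
  assume T: "T \<noteq> {} \<and> insert v T \<in> K"
  then have "T \<in> K" using assms unfolding abs_complex_def by blast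
  then show "T \<in> vertex_star K v" using T unfolding vertex_star_def by blast
qed

lemma vertex_link_iff:
  assumes "abs_complex K"
  shows "T \<in> vertex_link K v \<longleftrightarrow> T \<noteq> {} \<and> v \<notin> T \<and> insert v T \<in> K"
  using vertex_star_iff[OF assms] by (auto simp: vertex_link_def)

text \<open>The wall R formed by v and S without x lies in the top simplex
  \<open>insert v S\<close>. As v is interior, this is not the only top simplex containing R; a
  second one has exactly one vertex outside R, and this is the required w.\<close>

lemma closed_pure_link:
  fixes K :: "'v set set"
  assumes K: "abs_complex K" "abs_locally_finite K" "pure_dim n K" and n: "0 < n"
    and v: "interior_vertex n K v"
  shows "closed_pure n (vertex_link K v)"
proof -
  note link = vertex_link_iff[OF K(1), where v = v]
  have fin: "finite \<sigma>" if "\<sigma> \<in> K" for \<sigma> using K(1) that by (simp add: abs_complex_def)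
  note face = abs_complex_face[OF K(1)]
  have big: "\<exists>F\<in>vertex_link K v. \<sigma> \<subseteq> insert v F \<and> card F = n" if \<sigma>: "\<sigma> \<in> K" "v \<in> \<sigma>" for \<sigma>
  proof -
    obtain \<tau> where \<tau>: "\<tau> \<in> K" "\<sigma> \<subseteq> \<tau>" "card \<tau> = n + 1" using K(3) \<sigma>(1) unfolding pure_dim_def by blast
    have v\<tau>: "v \<in> \<tau>" using \<tau> \<sigma> by blast
    then have c: "card (\<tau> - {v}) = n" using \<tau>(3) fin[OF \<tau>(1)] by simp
    \<comment> \<open>Positive n enters here: the face opposite v must be nonempty to count as a
      simplex.\<close>
    then have "\<tau> - {v} \<noteq> {}" using n by (metis card.empty less_irrefl)
    then have "\<tau> - {v} \<in> vertex_link K v" using \<tau>(1) v\<tau> by (simp add: link insert_absorb)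
    then show ?thesis using c \<tau>(2) by (intro bexI[of _ "\<tau> - {v}"]) auto
  qed
  show ?thesis
    unfolding closed_pure_def
  proof (intro conjI ballI allI impI)
    have "finite {\<sigma>\<in>K. v \<in> \<sigma>}" using K(2) unfolding abs_locally_finite_def by blast
    moreover have "vertex_link K v \<subseteq> (\<lambda>\<sigma>. \<sigma> - {v}) ` {\<sigma>\<in>K. v \<in> \<sigma>}"
    proof
      fix T assume "T \<in> vertex_link K v"
      then have "insert v T \<in> {\<sigma>\<in>K. v \<in> \<sigma>}" "T = insert v T - {v}" by (auto simp: link)
      then show "T \<in> (\<lambda>\<sigma>. \<sigma> - {v}) ` {\<sigma>\<in>K. v \<in> \<sigma>}" by (rule rev_image_eqI)
    qed
    ultimately show "finite (vertex_link K v)" by (meson finite_imageI finite_subset)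
    obtain \<sigma> where "\<sigma> \<in> K" "v \<in> \<sigma>" using v by (auto simp: interior_vertex_def)
    then show "vertex_link K v \<noteq> {}" using big by blast
    fix S assume "S \<in> vertex_link K v"
    then have S: "S \<noteq> {}" "v \<notin> S" "insert v S \<in> K" by (auto simp: link)
    show "S \<noteq> {}" by fact
    show finS: "finite S" using fin[OF S(3)] by simp
    show "T \<in> vertex_link K v" if T: "T \<subseteq> S \<and> T \<noteq> {}" for T
    proof -
      have "insert v T \<in> K" by (rule face[OF S(3)]) (use T in auto)
      then show ?thesis using T S(2) by (auto simp: link)
    qed
    show "\<exists>F\<in>vertex_link K v. S \<subseteq> F \<and> card F = n" using big[OF S(3)] S(2) by blast
    fix x assume cS: "card S = n" and x: "x \<in> S"
    define R where "R = insert v (S - {x})"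
    have RK: "R \<in> K" unfolding R_def by (rule face[OF S(3)]) auto
    have cR: "card R = n" using S(2) x finS cS n by (simp add: R_def)
    have cSv: "card (insert v S) = n + 1" using S(2) finS cS by simp
    have "\<not> (\<exists>!\<sigma>. \<sigma> \<in> K \<and> card \<sigma> = n + 1 \<and> R \<subseteq> \<sigma>)"
      using v RK cR unfolding interior_vertex_def R_def by blast
    moreover have "insert v S \<in> K \<and> card (insert v S) = n + 1 \<and> R \<subseteq> insert v S"
      using S(3) cSv by (auto simp: R_def)
    ultimately obtain \<sigma> where \<sigma>: "\<sigma> \<in> K" "card \<sigma> = n + 1" "R \<subseteq> \<sigma>" "\<sigma> \<noteq> insert v S" by blast
    have "card (\<sigma> - R) = 1" using \<sigma> cR finS by (subst card_Diff_subset) (auto simp: R_def)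
    then obtain w where w: "\<sigma> - R = {w}" by (auto simp: card_1_singleton_iff)
    then have \<sigma>w: "\<sigma> = insert w R" using \<sigma>(3) by blast
    have wR: "w \<notin> R" using w by blast
    have "w \<noteq> x" using \<sigma>(4) x unfolding \<sigma>w R_def by blast
    then have "w \<notin> S" using wR by (auto simp: R_def)
    moreover have "insert w (S - {x}) \<in> vertex_link K v"
      using \<sigma>(1) wR S(2) unfolding \<sigma>w by (auto simp: link R_def insert_commute)
    ultimately show "\<exists>w. w \<notin> S \<and> insert w (S - {x}) \<in> vertex_link K v" by blast
  qed
qed

text \<open>Lengths come from Euclidean realisations of top simplices; positivity is needed for the
  logarithm that defines the conformal factor.\<close>

lemma edge_length_pos:
  assumes "tri_pe_manifold TYPE('n::finite) K l" "{a, b} \<in> K" "a \<noteq> b"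
  shows "0 < l a b"
proof -
  obtain \<tau> where \<tau>: "\<tau> \<in> K" "{a, b} \<subseteq> \<tau>" "card \<tau> = CARD('n) + 1"
    using assms(1,2) unfolding tri_pe_manifold_def pure_dim_def by metis
  then obtain f :: "'a \<Rightarrow> real^'n" where f: "inj_on f \<tau>"
    "\<forall>a\<in>\<tau>. \<forall>b\<in>\<tau>. a \<noteq> b \<longrightarrow> dist (f a) (f b) = l a b"
    using assms(1) unfolding tri_pe_manifold_def by metis
  have "f a \<noteq> f b" using f(1) \<tau>(2) assms(3) by (auto simp: inj_on_def)
  then have "0 < dist (f a) (f b)" by simp
  moreover have "dist (f a) (f b) = l a b" using f(2) \<tau>(2) assms(3) by blast
  ultimately show ?thesis by simp
qed

lemma simp_fan_subset: "simp_fan \<S> \<Longrightarrow> \<T> \<subseteq> \<S> \<Longrightarrow> simp_fan \<T>"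
  unfolding simp_fan_def by blast

lemma basis_support_vector:
  fixes F :: "'a::euclidean_space set"
  assumes "independent F"
  shows "\<exists>a. \<forall>u\<in>F. a \<bullet> u = 1"
proof -
  obtain g :: "'a \<Rightarrow> real" where g: "linear g" "\<forall>u\<in>F. g u = 1"
    using linear_independent_extend[OF assms, of "\<lambda>_. 1"] by auto
  have "adjoint g 1 \<bullet> u = g u" for u
    using adjoint_works[OF g(1), of u 1] by (simp add: inner_commute)
  then show ?thesis using g(2) by metis
qed

section \<open>The two implications at a single vertex\<close>

text \<open>Emptiness of circumballs towards adjacent simplices is, after inversion about the image
  of v0, exactly the local hypothesis of \<open>convex_fan_polytope\<close>.\<close>

lemma link_polytope_of_flat_star:
  fixes K :: "'v set set" and D :: "(real^'n::finite) set set"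
  assumes M: "tri_pe_manifold TYPE('n) K l" and v0: "interior_vertex CARD('n) K v0"
    and geom: "geom_complex TYPE('n) D" and del: "locally_delaunay TYPE('n) D"
    and equiv: "disc_conf_equiv (vertex_star K v0) l D"
  shows "\<exists>(P :: (real^'n) set) (L :: (real^'n) set set) \<phi>.
      polytope P \<and> geom_complex TYPE('n) L \<and> carrier L = frontier P \<and>
      bij_betw \<phi> (\<Union>(vertex_link K v0)) (\<Union>L) \<and>
      (\<forall>T. T \<subseteq> \<Union>(vertex_link K v0) \<longrightarrow> (T \<in> vertex_link K v0 \<longleftrightarrow> \<phi> ` T \<in> L)) \<and>
      (\<forall>a b. {a, b} \<in> vertex_link K v0 \<and> a \<noteq> b \<longrightarrow>
         dist (\<phi> a) (\<phi> b) = l a b / (l v0 a * l v0 b))"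
proof -
  have K: "abs_complex K" "abs_locally_finite K" "pure_dim CARD('n) K" using M by (auto simp: tri_pe_manifold_def)
  note star = vertex_star_iff[OF K(1)] and link = vertex_link_iff[OF K(1)]
  let ?S = "vertex_star K v0" and ?L = "vertex_link K v0"
  have cp: "closed_pure CARD('n) ?L" by (rule closed_pure_link[OF K _ v0]) simp
  obtain \<phi> u where \<phi>: "bij_betw \<phi> (\<Union>?S) (\<Union>D)"
    "\<And>T. T \<subseteq> \<Union>?S \<Longrightarrow> T \<in> ?S \<longleftrightarrow> \<phi> ` T \<in> D"
    "\<And>a b. {a, b} \<in> ?S \<Longrightarrow> a \<noteq> b \<Longrightarrow> dist (\<phi> a) (\<phi> b) = exp ((u a + u b) / 2) * l a b"
    using equiv unfolding disc_conf_equiv_def by metis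
  have inj: "inj_on \<phi> (\<Union>?S)" using \<phi>(1) by (simp add: bij_betw_def)
  have insS: "insert v0 T \<in> ?S" if "T \<in> ?L" for T using that by (simp add: star link)
  have v0S: "v0 \<in> \<Union>?S" using insS closed_pureD(2)[OF cp] by blast
  have LS: "\<Union>?L \<subseteq> \<Union>?S - {v0}" by (auto simp: vertex_link_def)
  define p where "p = \<phi> v0"
  \<comment> \<open>Solved from the distance formula: the conformal factors at i and j cancel, and
    \<open>exp (u v0)\<close> remains in the denominator.\<close>
  define r where "r = exp (u v0)"
  have r: "0 < r" by (simp add: r_def)
  define \<psi> where "\<psi> i = inversion r (- p + \<phi> i)" for i
  have \<phi>p: "- p + \<phi> i \<noteq> 0" if "i \<in> \<Union>?L" for i
  proof -
    have "i \<in> \<Union>?S" "i \<noteq> v0" using that LS by blast+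
    then have "\<phi> i \<noteq> p" using inj_onD[OF inj _ _ v0S] unfolding p_def by blast
    then show ?thesis by simp
  qed
  have inj\<psi>: "inj_on \<psi> (\<Union>?L)"
  proof (rule inj_onI)
    fix i j assume ij: "i \<in> \<Union>?L" "j \<in> \<Union>?L" "\<psi> i = \<psi> j"
    then have "\<phi> i = \<phi> j" unfolding \<psi>_def using inversion_inversion[OF r] by (metis add_left_cancel)
    then show "i = j" using inj ij(1,2) LS by (meson DiffD1 inj_onD subsetD)
  qed
  define \<S> where "\<S> = (`) \<psi> ` ?L"
  have cpS: "closed_pure CARD('n) \<S>" unfolding \<S>_def by (rule closed_pure_image[OF cp inj\<psi>])
  have fan: "simp_fan \<S>"
  proof (rule simp_fan_subset)
    show "simp_fan ((`) (inversion r) ` (\<lambda>\<sigma>. (+) (- p) ` (\<sigma> - {p})) ` {\<sigma>\<in>D. p \<in> \<sigma>})"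
      by (rule simp_fan_inversion[OF r star_simp_fan[OF geom]])
    show "\<S> \<subseteq> (`) (inversion r) ` (\<lambda>\<sigma>. (+) (- p) ` (\<sigma> - {p})) ` {\<sigma>\<in>D. p \<in> \<sigma>}"
    proof
      fix S assume "S \<in> \<S>"
      then obtain T where T: "T \<in> ?L" "S = \<psi> ` T" by (auto simp: \<S>_def)
      have "\<phi> ` insert v0 T \<in> D" using \<phi>(2) insS[OF T(1)] by blast
      then have m: "\<phi> ` insert v0 T \<in> {\<sigma>\<in>D. p \<in> \<sigma>}" by (simp add: p_def)
      have "p \<notin> \<phi> ` T" using \<phi>p T(1) by force
      then have e: "\<phi> ` insert v0 T - {p} = \<phi> ` T" by (auto simp: p_def)
      have "S = inversion r ` (+) (- p) ` (\<phi> ` insert v0 T - {p})"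
        unfolding T(2) e image_image by (rule image_cong) (simp_all add: \<psi>_def)
      then show "S \<in> (`) (inversion r) ` (\<lambda>\<sigma>. (+) (- p) ` (\<sigma> - {p})) ` {\<sigma>\<in>D. p \<in> \<sigma>}"
        by (rule ssubst) (intro imageI m)
    qed
  qed
  \<comment> \<open>Unique for a facet, which is a basis; an arbitrary choice for smaller
    simplices.\<close>
  define a where "a F = (SOME a. \<forall>u\<in>F. a \<bullet> u = 1)" for F :: "(real^'n) set"
  have a: "a F \<bullet> u = 1" if "F \<in> \<S>" "u \<in> F" for F u
  proof -
    have "\<forall>u\<in>F. a F \<bullet> u = 1"
      unfolding a_def by (rule someI_ex) (rule basis_support_vector[OF simp_fanD(2)[OF fan that(1)]])
    then show ?thesis using that(2) by blast
  qed
  define P where "P = convex hull insert 0 (\<Union>\<S>)"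
  have "carrier \<S> = frontier P"
    unfolding P_def
  proof (rule convex_fan_polytope[OF fan cpS a])
    fix F v w
    assume F: "F \<in> \<S>" "card F = CARD('n)" "v \<in> F" "w \<notin> F" and G: "insert w (F - {v}) \<in> \<S>"
    let ?G = "insert w (F - {v})"
    have finF: "finite F" by (rule closed_pureD(4)[OF cpS F(1)])
    have cG: "card ?G = CARD('n)" using F finF by simp
    obtain T where T: "T \<in> ?L" "F = \<psi> ` T" using F(1) by (auto simp: \<S>_def)
    obtain U where U: "U \<in> ?L" "?G = \<psi> ` U" using G by (auto simp: \<S>_def)
    have card\<psi>: "card (\<psi> ` X) = card X" if "X \<subseteq> \<Union>?L" for X
      by (rule card_image[OF inj_on_subset[OF inj\<psi> that]])
    have v0TU: "v0 \<notin> T" "v0 \<notin> U" using T(1) U(1) by (simp_all add: link)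
    have TU: "T \<subseteq> \<Union>?L" "U \<subseteq> \<Union>?L" using T(1) U(1) by blast+
    have finT: "finite T" "finite U" using closed_pureD(4)[OF cp] T(1) U(1) by auto
    have cT: "card T = CARD('n)" "card U = CARD('n)"
      using F(2) cG card\<psi>[OF TU(1)] card\<psi>[OF TU(2)] T(2) U(2) by simp_all
    have "\<psi> ` (T \<inter> U) = F \<inter> ?G"
      using inj_on_image_Int[OF inj\<psi> TU] unfolding T(2)[symmetric] U(2)[symmetric] .
    also have "\<dots> = F - {v}" using F(4) by auto
    finally have im: "\<psi> ` (T \<inter> U) = F - {v}" .
    have "T \<inter> U \<subseteq> \<Union>?L" using TU by blast
    from card\<psi>[OF this] have "card (T \<inter> U) = CARD('n) - 1" using im F(2,3) by simp
    \<comment> \<open>Star simplices over adjacent facets share their wall and also v0, which gives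
      the \<open>CARD('n)\<close> common vertices required by the Delaunay condition.\<close>
    then have cTU: "card (insert v0 (T \<inter> U)) = CARD('n)" using v0TU finT by simp
    let ?s = "\<phi> ` insert v0 T" and ?t = "\<phi> ` insert v0 U"
    have sub: "insert v0 T \<subseteq> \<Union>?S" "insert v0 U \<subseteq> \<Union>?S" using insS T(1) U(1) by blast+
    have card\<phi>: "card (\<phi> ` X) = card X" if "X \<subseteq> \<Union>?S" for X
      by (rule card_image[OF inj_on_subset[OF inj that]])
    have D: "?s \<in> D" "?t \<in> D" using \<phi>(2) sub insS T(1) U(1) by blast+
    have cs: "card ?s = CARD('n) + 1" "card ?t = CARD('n) + 1"
      using card\<phi>[OF sub(1)] card\<phi>[OF sub(2)] v0TU finT cT by simp_all
    have "insert v0 T \<inter> insert v0 U = insert v0 (T \<inter> U)" by blast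
    then have st: "?s \<inter> ?t = \<phi> ` insert v0 (T \<inter> U)"
      by (simp only: inj_on_image_Int[OF inj sub, symmetric])
    have "insert v0 (T \<inter> U) \<subseteq> \<Union>?S" by (rule order_trans[OF _ sub(1)]) blast
    then have cst: "card (?s \<inter> ?t) = CARD('n)" unfolding st by (simp only: card\<phi> cTU)
    \<comment> \<open>Reverses the correspondence of \<open>sphere_inversion\<close>:
      \<open>p + c\<close> is the circumcentre of the star simplex over F, and the radius is the
      norm of c because the sphere passes through p.\<close>
    define c where "c = (r / 2) *\<^sub>R a F"
    have ac: "(2 / r) *\<^sub>R c = a F" using r by (simp add: c_def)
    have tr: "dist (p + c) (\<phi> i) = dist c (- p + \<phi> i)" for i
      by (simp add: dist_norm algebra_simps)
    have sph: "dist (p + c) x = norm c" if "x \<in> ?s" for x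
    proof -
      consider "x = p" | i where "i \<in> T" "x = \<phi> i" using \<open>x \<in> ?s\<close> by (auto simp: p_def)
      then show ?thesis
      proof cases
        case 1
        then show ?thesis by (simp add: dist_norm)
      next
        case 2
        have i: "i \<in> \<Union>?L" using 2(1) TU(1) by blast
        have "a F \<bullet> \<psi> i = 1" using a[OF F(1)] T(2) 2(1) by blast
        then show ?thesis
          unfolding 2(2) tr sphere_inversion(2)[OF r \<phi>p[OF i]] ac by (simp only: \<psi>_def)
      qed
    qed
    have empty: "\<not> dist (p + c) q < norm c" if "q \<in> ?t" for q
      by (rule del[unfolded locally_delaunay_def, rule_format, of ?s ?t])
         (use D cs cst sph that in \<open>simp_all only: conj_assoc simp_thms\<close>)
    obtain j where j: "j \<in> U" "w = \<psi> j" using U(2) by blast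
    have jL: "j \<in> \<Union>?L" using j(1) TU(2) by blast
    have "\<not> dist (p + c) (\<phi> j) < norm c" by (rule empty) (use j(1) in simp)
    then have "\<not> 1 < a F \<bullet> \<psi> j"
      unfolding tr sphere_inversion(1)[OF r \<phi>p[OF jL]] ac by (simp only: \<psi>_def not_False_eq_True)
    then show "a F \<bullet> w \<le> 1" using j(2) by simp
  qed
  moreover have "polytope P"
  proof -
    have "finite (insert 0 (\<Union>\<S>))" using closed_pureD(1,4)[OF cpS] by simp
    then show ?thesis unfolding P_def polytope_def by blast
  qed
  moreover have "geom_complex TYPE('n) \<S>"
  proof (rule simp_fan_geom_complex[OF fan closed_pureD(1)[OF cpS]])
    show "{} \<notin> \<S>" using closed_pureD(3)[OF cpS] by blast
  qed (rule closed_pureD(5)[OF cpS])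
  moreover have "bij_betw \<psi> (\<Union>?L) (\<Union>\<S>)"
    using inj\<psi> by (auto simp: bij_betw_def \<S>_def)
  moreover have "T \<in> ?L \<longleftrightarrow> \<psi> ` T \<in> \<S>" if T: "T \<subseteq> \<Union>?L" for T
  proof
    assume "\<psi> ` T \<in> \<S>"
    then obtain U where U: "U \<in> ?L" "\<psi> ` T = \<psi> ` U" by (auto simp: \<S>_def)
    have UL: "U \<subseteq> \<Union>?L" using U(1) by blast
    have "T = U" by (rule inj_on_image_eq_iff[OF inj\<psi> T UL, THEN iffD1, OF U(2)])
    then show "T \<in> ?L" using U(1) by simp
  qed (simp add: \<S>_def)
  moreover have "dist (\<psi> i) (\<psi> j) = l i j / (l v0 i * l v0 j)" if ij: "{i, j} \<in> ?L" "i \<noteq> j" for i j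
  proof -
    have m: "i \<in> \<Union>?L" "j \<in> \<Union>?L" by (rule UnionI[OF ij(1)]; simp)+
    have "v0 \<noteq> i" "v0 \<noteq> j" using ij(1) by (simp_all add: link)
    moreover have "{i} \<in> ?L" "{j} \<in> ?L" by (rule closed_pureD(5)[OF cp ij(1)]; simp)+
    then have "{v0, i} \<in> ?S" "{v0, j} \<in> ?S" using insS by blast+
    moreover have "{i, j} \<in> ?S" using ij(1) by (simp add: vertex_link_def)
    ultimately have d: "dist (\<phi> v0) (\<phi> i) = exp ((u v0 + u i) / 2) * l v0 i"
        "dist (\<phi> v0) (\<phi> j) = exp ((u v0 + u j) / 2) * l v0 j"
        "dist (\<phi> i) (\<phi> j) = exp ((u i + u j) / 2) * l i j"
      using \<phi>(3) ij(2) by simp_all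
    have "dist (\<psi> i) (\<psi> j) = r * dist (\<phi> i) (\<phi> j) / (dist (\<phi> v0) (\<phi> i) * dist (\<phi> v0) (\<phi> j))"
      unfolding \<psi>_def dist_inversion[OF r \<phi>p[OF m(1)] \<phi>p[OF m(2)]]
      by (simp add: p_def dist_norm norm_minus_commute)
    also have "\<dots> = (exp (u v0) * exp ((u i + u j) / 2)) /
        (exp ((u v0 + u i) / 2) * exp ((u v0 + u j) / 2)) * (l i j / (l v0 i * l v0 j))"
      unfolding d r_def by (simp add: mult_ac)
    also have "exp (u v0) * exp ((u i + u j) / 2) = exp ((u v0 + u i) / 2) * exp ((u v0 + u j) / 2)"
      by (simp add: exp_add[symmetric] add_divide_distrib algebra_simps)
    finally show ?thesis by simp
  qed
  ultimately show ?thesis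
    by (intro exI[of _ P] exI[of _ \<S>] exI[of _ \<psi>]) simp
qed

text \<open>Seen from an interior point, each boundary simplex has a supporting plane at level 1.
  These planes are the hypothesis of \<open>convex_fan_delaunay_star\<close>.\<close>

lemma flat_star_of_link_polytope:
  fixes K :: "'v set set" and P :: "(real^'n::finite) set"
  assumes M: "tri_pe_manifold TYPE('n) K l" and v0: "interior_vertex CARD('n) K v0"
    and P: "polytope P" "geom_complex TYPE('n) L" "carrier L = frontier P"
    and \<psi>: "bij_betw \<psi> (\<Union>(vertex_link K v0)) (\<Union>L)"
      "\<And>T. T \<subseteq> \<Union>(vertex_link K v0) \<Longrightarrow> T \<in> vertex_link K v0 \<longleftrightarrow> \<psi> ` T \<in> L"
      "\<And>a b. {a, b} \<in> vertex_link K v0 \<Longrightarrow> a \<noteq> b \<Longrightarrow> dist (\<psi> a) (\<psi> b) = l a b / (l v0 a * l v0 b)"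
  shows "\<exists>D :: (real^'n) set set. discrete_domain TYPE('n) D \<and> locally_delaunay TYPE('n) D \<and>
    disc_conf_equiv (vertex_star K v0) l D"
proof -
  have K: "abs_complex K" "abs_locally_finite K" "pure_dim CARD('n) K" and lsym: "\<And>a b. l a b = l b a"
    using M by (auto simp: tri_pe_manifold_def)
  note star = vertex_star_iff[OF K(1)] and link = vertex_link_iff[OF K(1)]
  let ?S = "vertex_star K v0" and ?L = "vertex_link K v0"
  have cp: "closed_pure CARD('n) ?L" by (rule closed_pure_link[OF K _ v0]) simp
  have inj\<psi>: "inj_on \<psi> (\<Union>?L)" and \<psi>im: "\<psi> ` \<Union>?L = \<Union>L" using \<psi>(1) by (auto simp: bij_betw_def)
  \<comment> \<open>The vertex map is onto the vertices of L, so every simplex of L has a preimage,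
    and this preimage is a link simplex.\<close>
  have Leq: "L = (`) \<psi> ` ?L"
  proof (intro set_eqI iffI)
    fix S assume S: "S \<in> L"
    then have "S \<subseteq> \<psi> ` \<Union>?L" unfolding \<psi>im by blast
    then obtain T where T: "T \<subseteq> \<Union>?L" "S = \<psi> ` T" by (elim subset_imageE)
    have "T \<in> ?L" using \<psi>(2)[OF T(1)] S T(2) by simp
    then show "S \<in> (`) \<psi> ` ?L" unfolding T(2) by (rule imageI)
  next
    fix S assume "S \<in> (`) \<psi> ` ?L"
    then obtain T where T: "T \<in> ?L" "S = \<psi> ` T" by blast
    then have "T \<subseteq> \<Union>?L" by blast
    from \<psi>(2)[OF this] show "S \<in> L" using T by simp
  qed
  have cpL: "closed_pure CARD('n) L" unfolding Leq by (rule closed_pure_image[OF cp inj\<psi>])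
  have cvx: "convex P" and clo: "closed P" using P(1) by (auto simp: polytope_imp_convex polytope_imp_closed)
  obtain p where p: "p \<in> interior P"
    using interior_nonempty_of_frontier_complex[OF P(2) cpL cvx clo P(3)] by blast
  define \<S> where "\<S> = (`) ((+) (- p)) ` L"
  have hullL: "convex hull S \<subseteq> frontier P" if "S \<in> L" for S
    using that P(3) by (auto simp: carrier_def)
  have vertP: "x \<in> frontier P" if "x \<in> \<Union>L" for x
    using that hullL hull_inc[of x _ convex] by blast
  have frP: "frontier P \<subseteq> P" using clo by (auto simp: frontier_def)
  have supp: "\<exists>a. (\<forall>x\<in>S. a \<bullet> (x - p) = 1) \<and> (\<forall>y\<in>P. a \<bullet> (y - p) \<le> 1)" if "S \<in> L" for S
    using frontier_support[OF cvx clo p closed_pureD(4,3)[OF cpL that] hullL[OF that]] by metis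
  have fan: "simp_fan \<S>"
    unfolding \<S>_def
  proof (rule translated_simp_fan[OF P(2)])
    show "\<exists>a. \<forall>x\<in>S. a \<bullet> (x - p) = 1" if "S \<in> L" for S using supp[OF that] by blast
    show "t = 1" if "p + x \<in> carrier L" "0 < t" "p + t *\<^sub>R x \<in> carrier L" for x t
      using frontier_radial[OF cvx p] that unfolding P(3) by blast
  qed
  have cpS: "closed_pure CARD('n) \<S>" unfolding \<S>_def by (rule closed_pure_translation[OF cpL])
  have suppS: "\<exists>a. (\<forall>u\<in>F. a \<bullet> u = 1) \<and> (\<forall>q\<in>\<Union>\<S>. a \<bullet> q \<le> 1)" if F: "F \<in> \<S>" for F
  proof -
    obtain S where S: "S \<in> L" "F = (+) (- p) ` S" using F by (auto simp: \<S>_def)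
    obtain a where a: "\<forall>x\<in>S. a \<bullet> (x - p) = 1" "\<forall>y\<in>P. a \<bullet> (y - p) \<le> 1" using supp[OF S(1)] by blast
    have "a \<bullet> q \<le> 1" if q: "q \<in> \<Union>\<S>" for q
    proof -
      obtain T where T: "T \<in> L" "q \<in> (+) (- p) ` T" using q unfolding \<S>_def by blast
      then obtain y where y: "y \<in> T" "q = y - p" by auto
      have "y \<in> \<Union>L" using T(1) y(1) by blast
      then have "y \<in> P" using vertP frP by blast
      then show ?thesis using a(2) unfolding y(2) by blast
    qed
    moreover have "\<forall>u\<in>F. a \<bullet> u = 1" using a(1) by (auto simp: S(2))
    ultimately show ?thesis by blast
  qed
  define D where "D = {\<sigma>. \<sigma> \<noteq> {} \<and> (\<exists>S\<in>\<S>. \<sigma> \<subseteq> insert 0 (inversion 1 ` S))}"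
  have dom: "discrete_domain TYPE('n) D" "locally_delaunay TYPE('n) D"
    unfolding D_def by (rule convex_fan_delaunay_star[OF fan cpS suppS]; assumption)+
  define g where "g i = - p + \<psi> i" for i
  define \<phi> where "\<phi> i = (if i = v0 then 0 else inversion 1 (g i))" for i
  have Lv0: "v0 \<notin> \<Union>?L" by (auto simp: link)
  have US: "\<Union>?S = insert v0 (\<Union>?L)"
  proof (intro set_eqI iffI)
    fix x assume "x \<in> \<Union>?S"
    then obtain T where T: "x \<in> T" "insert v0 T \<in> K" by (auto simp: star)
    have "insert v0 {x} \<in> K" by (rule abs_complex_face[OF K(1) T(2)]) (use T(1) in auto)
    then have "{x} \<in> ?L" if "x \<noteq> v0" using that by (simp add: link)
    then show "x \<in> insert v0 (\<Union>?L)" by blast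
  next
    fix x assume x: "x \<in> insert v0 (\<Union>?L)"
    obtain T0 where T0: "T0 \<in> ?L" using closed_pureD(2)[OF cp] by blast
    have "insert v0 T \<in> ?S" if "T \<in> ?L" for T using that by (simp add: star link)
    then show "x \<in> \<Union>?S" using x T0 by blast
  qed
  have pfr: "p \<notin> frontier P" using p by (simp add: frontier_def)
  have g0: "g i \<noteq> 0" if "i \<in> \<Union>?L" for i
  proof -
    have "\<psi> i \<in> \<Union>L" using \<psi>im that by blast
    then have "\<psi> i \<noteq> p" using vertP pfr by blast
    then show ?thesis by (simp add: g_def)
  qed
  have inj: "inj_on \<phi> (\<Union>?S)"
  proof -
    have gi: "i = j" if "i \<in> \<Union>?L" "j \<in> \<Union>?L" "inversion 1 (g i) = inversion 1 (g j)" for i j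
    proof -
      have "g i = g j" using that(3) inversion_inversion[of 1] by (metis zero_less_one)
      then show ?thesis using inj\<psi> that(1,2) by (auto simp: g_def dest: inj_onD)
    qed
    show ?thesis
    proof (rule inj_onI)
      fix i j assume ij: "i \<in> \<Union>?S" "j \<in> \<Union>?S" "\<phi> i = \<phi> j"
      then show "i = j" using gi g0 unfolding US \<phi>_def by (auto split: if_splits)
    qed
  qed
  have \<phi>im: "\<phi> ` U = inversion 1 ` (+) (- p) ` \<psi> ` U" if "U \<in> ?L" for U
  proof -
    have "v0 \<notin> U" using that by (simp add: link)
    then show ?thesis unfolding image_image by (intro image_cong) (auto simp: \<phi>_def g_def)
  qed
  have Diff: "\<sigma> \<in> D \<longleftrightarrow> \<sigma> \<noteq> {} \<and> (\<exists>U\<in>?L. \<sigma> \<subseteq> \<phi> ` insert v0 U)" for \<sigma>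
  proof -
    have "\<phi> v0 = 0" by (simp add: \<phi>_def)
    then have "\<phi> ` insert v0 U = insert 0 (inversion 1 ` (+) (- p) ` \<psi> ` U)" if "U \<in> ?L" for U
      by (simp only: image_insert \<phi>im[OF that])
    then show ?thesis
      by (simp only: D_def \<S>_def Leq mem_Collect_eq bex_simps(7) cong: bex_cong)
  qed
  have iff: "T \<in> ?S \<longleftrightarrow> \<phi> ` T \<in> D" if T: "T \<subseteq> \<Union>?S" for T
  proof
    assume "T \<in> ?S"
    then have TK: "T \<noteq> {}" "insert v0 T \<in> K" by (auto simp: star)
    obtain U where U: "U \<in> ?L" "T \<subseteq> insert v0 U"
    \<comment> \<open>The simplex \<open>{v0}\<close> has no link part; it is a face of the cone
      over any link simplex.\<close>
    proof (cases "T - {v0} = {}")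
      case True
      obtain U where "U \<in> ?L" using closed_pureD(2)[OF cp] by blast
      moreover have "T \<subseteq> insert v0 U" using True by blast
      ultimately show ?thesis by (rule that)
    next
      case False
      show ?thesis
      proof (rule that)
        show "T - {v0} \<in> ?L" using TK(2) False by (simp add: link)
      qed blast
    qed
    have "\<phi> ` T \<subseteq> \<phi> ` insert v0 U" by (rule image_mono[OF U(2)])
    then show "\<phi> ` T \<in> D" unfolding Diff using TK(1) U(1) by auto
  next
    assume "\<phi> ` T \<in> D"
    then obtain U where U: "T \<noteq> {}" "U \<in> ?L" "\<phi> ` T \<subseteq> \<phi> ` insert v0 U"
      unfolding Diff by (elim conjE bexE) simp
    have US': "insert v0 U \<subseteq> \<Union>?S" using U(2) unfolding US by (simp add: Union_upper subset_insertI2)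
    have "T \<subseteq> insert v0 U" by (rule inj_on_image_subset_iff[OF inj T US', THEN iffD1, OF U(3)])
    then have TU: "insert v0 T \<subseteq> insert v0 U" by blast
    have "insert v0 U \<in> K" using U(2) by (simp add: link)
    then have "insert v0 T \<in> K" by (rule abs_complex_face[OF K(1) _ TU]) simp
    then show "T \<in> ?S" using U(1) by (simp add: star)
  qed
  have "\<phi> ` \<Union>?S = \<Union>D"
  proof (intro set_eqI iffI)
    fix x assume "x \<in> \<phi> ` \<Union>?S"
    then obtain T i where T: "T \<in> ?S" "i \<in> T" "x = \<phi> i" by blast
    then have "T \<subseteq> \<Union>?S" by blast
    from iff[OF this] have "\<phi> ` T \<in> D" using T(1) by simp
    then show "x \<in> \<Union>D" using T(2,3) by blast
  next
    fix x assume "x \<in> \<Union>D"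
    then obtain U where "U \<in> ?L" "x \<in> \<phi> ` insert v0 U" using Diff by blast
    then show "x \<in> \<phi> ` \<Union>?S" unfolding US by blast
  qed
  then have bij: "bij_betw \<phi> (\<Union>?S) (\<Union>D)" using inj by (simp add: bij_betw_def)
  \<comment> \<open>Solved from the edges at v0: with \<open>u v0\<close> set to 0, the inverted
    length \<open>1 / norm (g i)\<close> must equal \<open>exp (u i / 2) * l v0 i\<close>.\<close>
  define u where "u i = (if i = v0 then 0 else - 2 * ln (l v0 i * norm (g i)))" for i
  have lpos: "0 < l v0 i" if i: "i \<in> \<Union>?L" for i
  proof -
    obtain T where "T \<in> ?L" "i \<in> T" using i by blast
    then have "{i} \<in> ?L" using closed_pureD(5)[OF cp, of T "{i}"] by simp
    then have "{v0, i} \<in> K" "v0 \<noteq> i" by (auto simp: link)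
    then show ?thesis by (rule edge_length_pos[OF M])
  qed
  have exu: "exp (u i / 2) = 1 / (l v0 i * norm (g i))" if "i \<in> \<Union>?L" for i
  proof -
    have "i \<noteq> v0" using that Lv0 by blast
    then have "u i / 2 = - ln (l v0 i * norm (g i))" by (simp add: u_def)
    moreover have "0 < l v0 i * norm (g i)" using lpos[OF that] g0[OF that] by simp
    ultimately show ?thesis by (simp only: exp_minus exp_ln inverse_eq_divide)
  qed
  have exu0: "exp (u v0 / 2) = 1" by (simp add: u_def)
  have ex2: "exp ((u i + u j) / 2) = exp (u i / 2) * exp (u j / 2)" for i j
    by (simp add: add_divide_distrib exp_add)
  have radius: "dist (\<phi> v0) (\<phi> i) = exp ((u v0 + u i) / 2) * l v0 i" if i: "i \<in> \<Union>?L" for i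
  proof -
    have "i \<noteq> v0" using i Lv0 by blast
    then have "dist (\<phi> v0) (\<phi> i) = norm (inversion 1 (g i))" by (simp add: \<phi>_def)
    also have "\<dots> = 1 / norm (g i)" using g0[OF i] by (simp add: inversion_def power2_eq_square)
    finally show ?thesis using lpos[OF i] by (simp add: ex2 exu0 exu[OF i])
  qed
  have "dist (\<phi> i) (\<phi> j) = exp ((u i + u j) / 2) * l i j" if ij: "{i, j} \<in> ?S" "i \<noteq> j" for i j
  proof -
    have mem: "i \<in> insert v0 (\<Union>?L)" "j \<in> insert v0 (\<Union>?L)" 
      unfolding US[symmetric] by (rule UnionI[OF ij(1)]; simp)+
    consider "i = v0" "j \<in> \<Union>?L" | "j = v0" "i \<in> \<Union>?L" | "i \<noteq> v0" "j \<noteq> v0" "i \<in> \<Union>?L" "j \<in> \<Union>?L"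
      using mem ij(2) by blast
    then show ?thesis
    proof cases
      case 1
      then show ?thesis using radius by simp
    next
      case 2
      then show ?thesis using radius[of i] lsym[of i v0] by (simp add: dist_commute add.commute)
    next
      case 3
      have "{i, j} \<in> ?L" using ij(1) 3 by (simp add: star link)
      then have d: "dist (\<psi> i) (\<psi> j) = l i j / (l v0 i * l v0 j)" using \<psi>(3) ij(2) by blast
      \<comment> \<open>The norms contributed by the inversion and the lengths
        \<open>l v0 i\<close>, \<open>l v0 j\<close> in the link metric combine to the two
        exponentials.\<close>
      have "dist (\<phi> i) (\<phi> j) = dist (g i) (g j) / (norm (g i) * norm (g j))"
        using dist_inversion[of 1 "g i" "g j"] g0 3 by (simp add: \<phi>_def)
      also have "dist (g i) (g j) = dist (\<psi> i) (\<psi> j)" by (simp add: g_def dist_norm)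
      finally show ?thesis unfolding d by (simp add: ex2 exu[OF 3(3)] exu[OF 3(4)])
    qed
  qed
  then have "disc_conf_equiv ?S l D"
    unfolding disc_conf_equiv_def using bij iff by (intro exI[of _ \<phi>] exI[of _ u]) simp
  then show ?thesis using dom by blast
qed

theorem theorem2:
  fixes K :: "'v set set" and l :: "'v \<Rightarrow> 'v \<Rightarrow> real"
  assumes "tri_pe_manifold TYPE('n::finite) K l"
  shows "disc_conf_flat TYPE('n) K l \<longleftrightarrow>
    (\<forall>v0. interior_vertex CARD('n) K v0 \<longrightarrow>
       (\<exists>(P :: (real^'n) set) (L :: (real^'n) set set) \<phi>.
          polytope P \<and> geom_complex TYPE('n) L \<and> carrier L = frontier P \<and>
          bij_betw \<phi> (\<Union>(vertex_link K v0)) (\<Union>L) \<and>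
          (\<forall>T. T \<subseteq> \<Union>(vertex_link K v0) \<longrightarrow> (T \<in> vertex_link K v0 \<longleftrightarrow> \<phi> ` T \<in> L)) \<and>
          (\<forall>a b. {a, b} \<in> vertex_link K v0 \<and> a \<noteq> b \<longrightarrow>
             dist (\<phi> a) (\<phi> b) = l a b / (l v0 a * l v0 b))))"
    (is "_ \<longleftrightarrow> (\<forall>v0. _ \<longrightarrow> ?link v0)")
  unfolding disc_conf_flat_def
proof (intro iff_allI imp_cong refl iffI)
  fix v0
  assume v0: "interior_vertex CARD('n) K v0"
  {
    assume "\<exists>D :: (real^'n) set set. discrete_domain TYPE('n) D \<and> locally_delaunay TYPE('n) D \<and>
      disc_conf_equiv (vertex_star K v0) l D"
    then obtain D :: "(real^'n) set set" where D: "discrete_domain TYPE('n) D"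
      "locally_delaunay TYPE('n) D" "disc_conf_equiv (vertex_star K v0) l D"
      by (elim exE conjE)
    have "geom_complex TYPE('n) D" using D(1) by (simp only: discrete_domain_def)
    then show "?link v0"
      by (rule link_polytope_of_flat_star[OF assms v0 _ D(2,3)])
  next
    assume "?link v0"
    then obtain P :: "(real^'n) set" and L \<phi> where P: "polytope P" "geom_complex TYPE('n) L"
      "carrier L = frontier P" "bij_betw \<phi> (\<Union>(vertex_link K v0)) (\<Union>L)"
      and T: "\<forall>T. T \<subseteq> \<Union>(vertex_link K v0) \<longrightarrow> (T \<in> vertex_link K v0 \<longleftrightarrow> \<phi> ` T \<in> L)"
      and d: "\<forall>a b. {a, b} \<in> vertex_link K v0 \<and> a \<noteq> b \<longrightarrow>
             dist (\<phi> a) (\<phi> b) = l a b / (l v0 a * l v0 b)"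
      by (elim exE conjE)
    show "\<exists>D :: (real^'n) set set. discrete_domain TYPE('n) D \<and> locally_delaunay TYPE('n) D \<and>
        disc_conf_equiv (vertex_star K v0) l D"
      by (rule flat_star_of_link_polytope[OF assms v0 P T[rule_format] d[rule_format, OF conjI]])
  }
qed

end
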